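(* Let $\alpha>-1$ and $\tilde\lambda>0$, and let $\tilde a=\frac{\tilde\lambda+2-\sqrt{\tilde\lambda^2+4\tilde\lambda}}{2}$. For $0<c<1$ put $\beta=\alpha+1$, $\lambda=\frac{\tilde\lambda}{(1-c)^2}$ and $\eta=1+\lambda\left(1-\frac1c\right)^2=1+\frac{\tilde\lambda}{c^2}$. Let $S_n$ be the $\Delta$-Meixner-Sobolev orthogonal polynomials with parameters $\beta,c,\lambda$, let $q_n(\eta)$ be the associated sequence, let $S_n^L$ be the Laguerre-Sobolev orthogonal polynomials with parameters $\alpha,\tilde\lambda$, and let $q_n^L(\tilde\lambda)$ be the associated sequence (all defined in the context). Let $$G_M(x,\omega,\lambda)=\sum_{n=0}^{+\infty}q_n(\eta)S_n(x)\omega^n,\qquad G_L(x,\omega,\tilde\lambda)=\sum_{n=0}^{+\infty}q_n^L(\tilde\lambda)S_n^L(x)\omega^n .$$ Then, for all $x$ and all $\omega$ with $|\omega|<\tilde a$, $$\lim_{c\uparrow1}G_M\!\left(\frac{x}{1-c},\,c\,\omega,\,\frac{\tilde\lambda}{(1-c)^2}\right)=\lim_{c\uparrow 1}\sum_{n=0}^{+\infty}q_n(\eta)\,S_n\!\left(\frac{x}{1-c}\right)c^n\omega^n=G_L(x,\omega,\tilde\lambda).$$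
   Context: $\Delta f(k)=f(k+1)-f(k)$; $(\beta)_0=1$, $(\beta)_k=\beta(\beta+1)\cdots(\beta+k-1)$. $\Delta$-Meixner-Sobolev polynomials: for $\beta>0$, $0<c<1$, $\lambda>0$, $\{S_n\}_{n\ge0}$ is the sequence of polynomials ($\deg S_n=n$) orthogonal with respect to $(f,g)_S=\sum_{k\ge0}f(k)g(k)\frac{c^k(\beta)_k}{k!}+\lambda\sum_{k\ge0}\Delta f(k)\Delta g(k)\frac{c^k(\beta)_k}{k!}$, with leading coefficient of $S_n$ equal to $\frac1{n!}\left(1-\frac1c\right)^n$. The sequence $q_n(\eta)$ is defined by $q_0(\eta)=q_1(\eta)=1$ and $(n+\beta-1)q_{n+1}(\eta)=(n+\beta-1+\eta cn)q_n(\eta)-cn\,q_{n-1}(\eta)$ for $n\ge1$. Both depend on $c$ (with $\beta,\lambda,\eta$ as functions of $c$ as in the claim). Laguerre-Sobolev polynomials: for $\alpha>-1$, $\tilde\lambda>0$, $\{S_n^L\}_{n\ge0}$ is the sequence of polynomials ($\deg S_n^L=n$) with leading coefficient $(-1)^n/n!$ orthogonal with respect to $(f,g)_{\tilde S}=\int_0^{+\infty}f(x)g(x)x^\alpha e^{-x}dx+\tilde\lambda\int_0^{+\infty}f'(x)g'(x)x^\alpha e^{-x}dx$. The sequence $q_n^L(\tilde\lambda)$ is defined by $q_0^L(\tilde\lambda)=q_1^L(\tilde\lambda)=1$ and $(n+\alpha)q_{n+1}^L(\tilde\lambda)=[n(\tilde\lambda+2)+\alpha]\,q_n^L(\tilde\lambda)-n\,q_{n-1}^L(\tilde\lambda)$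 for $n\ge1$. The series defining $G_M$ in the claim is considered for $c$ close enough to $1$ that it converges: it converges for $|\omega|<a$ with $a=\frac{1+\eta c-\sqrt{(1+\eta c)^2-4c}}{2c}$, and $a\to\tilde a$ as $c\uparrow1$. *)

theory Defs
  imports "HOL-Analysis.Analysis" "HOL-Computational_Algebra.Polynomial"
begin

definition forward_diff :: "(real \<Rightarrow> real) \<Rightarrow> real \<Rightarrow> real" where
  "forward_diff f x = f (x + 1) - f x"

definition meixner_weight :: "real \<Rightarrow> real \<Rightarrow> nat \<Rightarrow> real" where
  "meixner_weight \<beta> c k = c ^ k * pochhammer \<beta> k / fact k"

definition meixner_sobolev_ip :: "real \<Rightarrow> real \<Rightarrow> real \<Rightarrow> real poly \<Rightarrow> real poly \<Rightarrow> real" where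
  "meixner_sobolev_ip \<beta> c lam f g =
     (\<Sum>k. poly f (real k) * poly g (real k) * meixner_weight \<beta> c k) +
     lam * (\<Sum>k. forward_diff (poly f) (real k) * forward_diff (poly g) (real k)
                   * meixner_weight \<beta> c k)"

definition laguerre_sobolev_ip :: "real \<Rightarrow> real \<Rightarrow> real poly \<Rightarrow> real poly \<Rightarrow> real" where
  "laguerre_sobolev_ip \<alpha> lam f g =
     (LBINT x:{0<..}. poly f x * poly g x * x powr \<alpha> * exp (- x)) +
     lam * (LBINT x:{0<..}. poly (pderiv f) x * poly (pderiv g) x * x powr \<alpha> * exp (- x))"

definition orthogonal_polys ::
    "(real poly \<Rightarrow> real poly \<Rightarrow> real) \<Rightarrow> (nat \<Rightarrow> real) \<Rightarrow> (nat \<Rightarrow> real poly) \<Rightarrow> bool" where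
  "orthogonal_polys ip \<kappa> P \<longleftrightarrow>
     (\<forall>n. degree (P n) = n \<and> lead_coeff (P n) = \<kappa> n) \<and>
     (\<forall>m n. m \<noteq> n \<longrightarrow> ip (P m) (P n) = 0)"

definition is_meixner_sobolev :: "real \<Rightarrow> real \<Rightarrow> real \<Rightarrow> (nat \<Rightarrow> real poly) \<Rightarrow> bool" where
  "is_meixner_sobolev \<beta> c lam S \<longleftrightarrow>
     orthogonal_polys (meixner_sobolev_ip \<beta> c lam) (\<lambda>n. 1 / fact n * (1 - 1 / c) ^ n) S"

definition is_laguerre_sobolev :: "real \<Rightarrow> real \<Rightarrow> (nat \<Rightarrow> real poly) \<Rightarrow> bool" where
  "is_laguerre_sobolev \<alpha> lam S \<longleftrightarrow>
     orthogonal_polys (laguerre_sobolev_ip \<alpha> lam) (\<lambda>n. (- 1) ^ n / fact n) S"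

text \<open>
  Both recurrences below are solved for their leading term and shifted by one index, so
  the original index \<open>n \<ge> 1\<close> is \<open>Suc n\<close> here. The divisors are positive whenever
  \<open>\<beta> > 0\<close>, respectively \<open>\<alpha> > -1\<close>.
\<close>

fun meixner_q :: "real \<Rightarrow> real \<Rightarrow> real \<Rightarrow> nat \<Rightarrow> real" where
  "meixner_q \<beta> c \<eta> 0 = 1"
| "meixner_q \<beta> c \<eta> (Suc 0) = 1"
| "meixner_q \<beta> c \<eta> (Suc (Suc n)) =
     ((real (Suc n) + \<beta> - 1 + \<eta> * c * real (Suc n)) * meixner_q \<beta> c \<eta> (Suc n)
        - c * real (Suc n) * meixner_q \<beta> c \<eta> n) / (real (Suc n) + \<beta> - 1)"

fun laguerre_q :: "real \<Rightarrow> real \<Rightarrow> nat \<Rightarrow> real" where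
  "laguerre_q \<alpha> lam 0 = 1"
| "laguerre_q \<alpha> lam (Suc 0) = 1"
| "laguerre_q \<alpha> lam (Suc (Suc n)) =
     ((real (Suc n) * (lam + 2) + \<alpha>) * laguerre_q \<alpha> lam (Suc n)
        - real (Suc n) * laguerre_q \<alpha> lam n) / (real (Suc n) + \<alpha>)"

abbreviation cpoly :: "real poly \<Rightarrow> complex \<Rightarrow> complex" where
  "cpoly p \<equiv> poly (map_poly complex_of_real p)"

definition meixner_eta :: "real \<Rightarrow> real \<Rightarrow> real" where
  "meixner_eta c lam = 1 + lam * (1 - 1 / c)\<^sup>2"

text \<open>
  In \<open>G_M\<close> and \<open>G_L\<close> the argument \<open>S\<close> is the corresponding sequence of Sobolev
  orthogonal polynomials; in \<open>G_M\<close> it is the one for the parameters \<open>\<beta>\<close>, \<open>c\<close>, \<open>lam\<close>.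
\<close>

definition G_M ::
    "real \<Rightarrow> real \<Rightarrow> (nat \<Rightarrow> real poly) \<Rightarrow> complex \<Rightarrow> complex \<Rightarrow> real \<Rightarrow> complex" where
  "G_M \<beta> c S x \<omega> lam =
     (\<Sum>n. of_real (meixner_q \<beta> c (meixner_eta c lam) n) * cpoly (S n) x * \<omega> ^ n)"

definition G_L :: "real \<Rightarrow> (nat \<Rightarrow> real poly) \<Rightarrow> complex \<Rightarrow> complex \<Rightarrow> real \<Rightarrow> complex" where
  "G_L \<alpha> S x \<omega> lam = (\<Sum>n. of_real (laguerre_q \<alpha> lam n) * cpoly (S n) x * \<omega> ^ n)"

end

theory Submission imports Defs begin

text \<open>
  Let \<open>m\<^sub>n\<close> be the Meixner (Laguerre) polynomials with parameter \<open>\<beta>\<close> (\<open>\<alpha> = \<beta> - 1\<close>) and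
  \<open>p\<^sub>n = m\<^sub>n - m\<^sub>n\<^sub>-\<^sub>1\<close> those with the parameter lowered by one. The difference operator
  (derivative) maps \<open>p\<^sub>n\<close> to \<open>z m\<^sub>n\<^sub>-\<^sub>1\<close>, so the Sobolev Gram matrix of the \<open>p\<^sub>n\<close> is tridiagonal, and
  the recurrence of \<open>q\<^sub>n\<close> is what makes \<open>\<Sum>\<^sub>k\<^sub>\<le>\<^sub>n q\<^sub>k p\<^sub>k\<close> Sobolev orthogonal to all polynomials of
  degree below \<open>n\<close>; hence \<open>q\<^sub>n S\<^sub>n = \<Sum>\<^sub>k\<^sub>\<le>\<^sub>n q\<^sub>k p\<^sub>k\<close>. After the substitution \<open>x / (1 - c)\<close> the terms of
  the Meixner series converge to those of the Laguerre series as \<open>c\<close> tends to 1. The \<open>q\<^sub>n\<close> grow at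
  most like \<open>\<sigma>\<^sup>-\<^sup>n\<close> for every positive \<open>\<sigma>\<close> below the smaller root of \<open>t\<^sup>2 - (\<lambda> + 2) t + 1\<close>, and the rescaled
  \<open>p\<^sub>n\<close> grow subexponentially, both uniformly for \<open>c\<close> near 1, so Tannery's theorem applies.
\<close>

section \<open>Sobolev orthogonality from a moment functional\<close>

definition linear_functional :: "(real poly \<Rightarrow> real) \<Rightarrow> bool" where
  "linear_functional \<phi> \<longleftrightarrow>
     (\<forall>f g. \<phi> (f + g) = \<phi> f + \<phi> g) \<and> (\<forall>a f. \<phi> (smult a f) = a * \<phi> f)"

lemma linear_functionalD:
  assumes "linear_functional \<phi>"
  shows "\<phi> (f + g) = \<phi> f + \<phi> g" "\<phi> (smult a f) = a * \<phi> f" "\<phi> 0 = 0"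
    "\<phi> (f - g) = \<phi> f - \<phi> g" "\<phi> (\<Sum>i\<in>I. F i) = (\<Sum>i\<in>I. \<phi> (F i))"
proof -
  show add: "\<phi> (f + g) = \<phi> f + \<phi> g" and scale: "\<phi> (smult a f) = a * \<phi> f" for a f g
    using assms by (auto simp: linear_functional_def)
  show zero: "\<phi> 0 = 0"
    using scale[of 0 0] by simp
  show "\<phi> (f - g) = \<phi> f - \<phi> g"
    using add[of f "smult (-1) g"] scale[of "-1" g] by simp
  show "\<phi> (\<Sum>i\<in>I. F i) = (\<Sum>i\<in>I. \<phi> (F i))"
    by (induction I rule: infinite_finite_induct) (simp_all add: add zero)
qed

lemma smult_sum_right: "smult a (\<Sum>i\<in>I. f i) = (\<Sum>i\<in>I. smult a (f i))"
  by (induction I rule: infinite_finite_induct) (simp_all add: smult_add_right)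

text \<open>Subtracting the multiple of \<open>e n\<close> that matches the coefficient at
  \<open>n\<close> lowers the bound by one. The property \<open>P\<close> is abstract because it
  will be summability and integrability as well as the vanishing of a functional.\<close>

lemma poly_triangular_span:
  fixes f :: "real poly"
  assumes "P 0" and "\<And>f g. P f \<Longrightarrow> P g \<Longrightarrow> P (f + g)" and "\<And>a f. P f \<Longrightarrow> P (smult a f)"
    and "\<And>j. degree (e j) \<le> j" and "\<And>j. coeff (e j) j \<noteq> 0"
    and "\<And>j. j < n \<Longrightarrow> P (e j)"
    and "\<And>i. i \<ge> n \<Longrightarrow> coeff f i = 0"
  shows "P f"
  using assms(6,7)
proof (induction n arbitrary: f)
  case 0
  then have "f = 0"
    by (simp add: poly_eq_iff)
  then show ?case
    using assms(1) by simp
next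
  case (Suc n)
  define a where "a = coeff f n / coeff (e n) n"
  have "coeff (f - smult a (e n)) i = 0" if "i \<ge> n" for i
  proof (cases "i = n")
    case True
    then show ?thesis
      using assms(5)[of n] by (simp add: a_def)
  next
    case False
    with that have "i \<ge> Suc n" by simp
    then show ?thesis
      using Suc.prems(2)[of i] assms(4)[of n] by (simp add: coeff_eq_0)
  qed
  then have "P (f - smult a (e n))"
    using Suc.IH Suc.prems(1) by simp
  moreover have "P (smult a (e n))"
    using Suc.prems(1) assms(3) by simp
  ultimately show ?case
    using assms(2) by fastforce
qed

text \<open>Once the right multiple of \<open>e n\<close> is removed, the rest lies in the span of
  the earlier basis elements, where \<open>\<phi>\<close> vanishes. This turns orthogonality to a
  basis into an explicit formula for all polynomials of degree at most \<open>n\<close>.\<close>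

lemma linear_functional_triangular:
  assumes "linear_functional \<phi>"
    and "\<And>j. degree (e j) \<le> j" and "\<And>j. coeff (e j) j \<noteq> 0"
    and "\<And>j. j < n \<Longrightarrow> \<phi> (e j) = 0"
    and "degree f \<le> n"
  shows "\<phi> f = coeff f n / coeff (e n) n * \<phi> (e n)"
proof -
  define a where "a = coeff f n / coeff (e n) n"
  have "coeff (f - smult a (e n)) i = 0" if "i \<ge> n" for i
    using that assms(2)[of n] assms(3)[of n] assms(5)
    by (cases "i = n") (simp_all add: a_def coeff_eq_0)
  then have "\<phi> (f - smult a (e n)) = 0"
    by (rule poly_triangular_span[of "\<lambda>f. \<phi> f = 0" e n, rotated -1])
      (use assms in \<open>auto simp: linear_functionalD\<close>)
  then show ?thesis
    by (simp add: linear_functionalD[OF assms(1)] a_def)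
qed

section \<open>Finite differences of rising factorials\<close>

lemma alternating_binomial_sum_Suc:
  fixes f :: "nat \<Rightarrow> real"
  shows "(\<Sum>j\<le>Suc n. (-1) ^ j * real (Suc n choose j) * f j) =
    (\<Sum>j\<le>n. (-1) ^ j * real (n choose j) * (f j - f (Suc j)))"
proof -
  have "(\<Sum>j\<le>Suc n. (-1) ^ j * real (Suc n choose j) * f j) =
     (\<Sum>j\<le>Suc n. (-1) ^ j * real (n choose j) * f j) -
     (\<Sum>j\<le>n. (-1) ^ j * real (n choose j) * f (Suc j))"
    unfolding sum.atMost_Suc_shift
    by (simp add: algebra_simps sum.distrib sum_negf sum_subtractf)
  also have "(\<Sum>j\<le>Suc n. (-1) ^ j * real (n choose j) * f j) =
     (\<Sum>j\<le>n. (-1) ^ j * real (n choose j) * f j)"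
    by simp
  finally show ?thesis
    by (simp add: algebra_simps sum_subtractf)
qed

text \<open>Each use of Pascal's rule replaces the summand by a difference and lowers its degree in
  \<open>j\<close> by one, so the \<open>n\<close>-th difference annihilates degrees below
  \<open>n\<close>. The base \<open>a\<close> stays arbitrary because a difference step shifts it to
  \<open>a + 1\<close>.\<close>

lemma alternating_binomial_sum_pochhammer:
  fixes a :: real
  assumes "i \<le> n"
  shows "(\<Sum>j\<le>n. (-1) ^ j * real (n choose j) * pochhammer (a + real j) i) =
    (if i = n then (-1) ^ n * fact n else 0)"
  using assms
proof (induction n arbitrary: i a)
  case 0
  then show ?case by simp
next
  case (Suc n)
  show ?case
  proof (cases i)
    case 0
    then show ?thesis
      unfolding alternating_binomial_sum_Suc by simp
  next
    case (Suc k)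
    have diff: "pochhammer (a + real j) (Suc k) - pochhammer (a + real (Suc j)) (Suc k) =
        - real (Suc k) * pochhammer (a + 1 + real j) k" for j
    proof -
      have "pochhammer (a + real j) (Suc k) = (a + real j) * pochhammer (a + 1 + real j) k"
        by (simp add: pochhammer_rec algebra_simps)
      moreover have "pochhammer (a + real (Suc j)) (Suc k) =
          pochhammer (a + 1 + real j) k * (a + 1 + real j + real k)"
        by (simp add: pochhammer_Suc algebra_simps)
      ultimately show ?thesis
        by (simp add: algebra_simps)
    qed
    have "(\<Sum>j\<le>Suc n. (-1) ^ j * real (Suc n choose j) * pochhammer (a + real j) i) =
        (\<Sum>j\<le>n. - real (Suc k) * ((-1) ^ j * real (n choose j) * pochhammer (a + 1 + real j) k))"
      unfolding alternating_binomial_sum_Suc \<open>i = Suc k\<close> diff by (simp add: mult_ac)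
    also have "\<dots> = - real (Suc k) * (if k = n then (-1) ^ n * fact n else 0)"
      unfolding sum_distrib_left[symmetric] using Suc.IH[of k "a + 1"] Suc.prems \<open>i = Suc k\<close> by simp
    finally show ?thesis
      using \<open>i = Suc k\<close> by (auto simp: algebra_simps)
  qed
qed

text \<open>Solved for the increment, the recurrence makes \<open>q (n + 2) - q (n + 1)\<close> a
  positive multiple of \<open>\<eta> * q (n + 1) - q n\<close>, which is nonnegative when
  \<open>q\<close> is positive and has not decreased so far. Hence both claims go through the
  induction together.\<close>

lemma meixner_q_mono:
  assumes "\<beta> > 0" "c > 0" "\<eta> \<ge> 1"
  shows "0 < meixner_q \<beta> c \<eta> n \<and> meixner_q \<beta> c \<eta> n \<le> meixner_q \<beta> c \<eta> (Suc n)"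
proof (induction n)
  case 0
  then show ?case by simp
next
  case (Suc n)
  define q where "q = meixner_q \<beta> c \<eta>"
  have d: "real (Suc n) + \<beta> - 1 > 0"
    using assms by simp
  have "q (Suc (Suc n)) = ((real (Suc n) + \<beta> - 1 + \<eta> * c * real (Suc n)) * q (Suc n)
        - c * real (Suc n) * q n) / (real (Suc n) + \<beta> - 1)"
    by (simp add: q_def)
  then have eq: "q (Suc (Suc n)) - q (Suc n) =
      c * real (Suc n) * (\<eta> * q (Suc n) - q n) / (real (Suc n) + \<beta> - 1)"
    using d by (simp add: field_simps)
  have pos: "q (Suc n) > 0" "q n \<le> q (Suc n)"
    using Suc by (auto simp: q_def)
  then have "\<eta> * q (Suc n) - q n \<ge> 0"
    using mult_right_mono[OF assms(3), of "q (Suc n)"] by linarith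
  then have "q (Suc (Suc n)) - q (Suc n) \<ge> 0"
    unfolding eq using d assms by (intro divide_nonneg_pos mult_nonneg_nonneg) auto
  then show ?case
    using pos by (simp add: q_def)
qed


text \<open>
  With \<open>b j = (1 - 1/c)\<^sup>j (x choose j)\<close> these are the Meixner polynomials and with
  \<open>b j = (-x)\<^sup>j / j!\<close> the Laguerre polynomials, in the normalisation of the theorem; \<open>\<gamma>\<close> is the
  parameter \<open>\<beta>\<close>, respectively \<open>\<alpha> + 1\<close>.
\<close>

definition hyp_poly :: "(nat \<Rightarrow> real poly) \<Rightarrow> real \<Rightarrow> nat \<Rightarrow> real poly" where
  "hyp_poly b \<gamma> n = (\<Sum>j\<le>n. smult (pochhammer (\<gamma> + real j) (n - j) / fact (n - j)) (b j))"

text \<open>The identity holds coefficient by coefficient and is a Pascal rule for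
  \<open>pochhammer \<gamma> k / fact k\<close>. The top term \<open>j = Suc n\<close> has
  coefficient 1 on both sides.\<close>

lemma hyp_poly_diff:
  "hyp_poly b (\<gamma> - 1) (Suc n) = hyp_poly b \<gamma> (Suc n) - hyp_poly b \<gamma> n"
proof -
  have *: "pochhammer (\<gamma> - 1 + real j) (Suc n - j) / fact (Suc n - j) =
      pochhammer (\<gamma> + real j) (Suc n - j) / fact (Suc n - j) -
      pochhammer (\<gamma> + real j) (n - j) / (fact (n - j) :: real)" if "j \<le> n" for j
  proof -
    define k where "k = n - j"
    have k: "Suc n - j = Suc k"
      using that by (simp add: k_def Suc_diff_le)
    have 1: "pochhammer (\<gamma> - 1 + real j) (Suc k) = (\<gamma> - 1 + real j) * pochhammer (\<gamma> + real j) k"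
      by (simp add: pochhammer_rec algebra_simps)
    have 2: "pochhammer (\<gamma> + real j) (Suc k) = pochhammer (\<gamma> + real j) k * (\<gamma> + real j + real k)"
      by (simp add: pochhammer_Suc)
    have "real (Suc k) > 0" by simp
    then show ?thesis
      unfolding k k_def[symmetric] 1 2 fact_Suc by (simp add: divide_simps del: of_nat_Suc) (simp add: algebra_simps)
  qed
  have "(\<Sum>j\<le>n. smult (pochhammer (\<gamma> - 1 + real j) (Suc n - j) / fact (Suc n - j)) (b j)) =
     (\<Sum>j\<le>n. smult (pochhammer (\<gamma> + real j) (Suc n - j) / fact (Suc n - j)) (b j) -
        smult (pochhammer (\<gamma> + real j) (n - j) / fact (n - j)) (b j))"
    by (intro sum.cong refl) (simp only: * atMost_iff smult_diff_left)
  then show ?thesis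
    by (simp add: hyp_poly_def sum_subtractf)
qed

text \<open>
  For Meixner the test polynomials \<open>g i\<close> are the rising factorials \<open>(\<beta> + x)\<^sub>i\<close>, for Laguerre they
  are the powers \<open>x\<^sup>i\<close>; in both cases \<open>L (b j * g i)\<close> has the same shape, and orthogonality
  reduces to a finite difference of \<open>(\<beta> + j)\<^sub>i\<close> in \<open>j\<close>. Laguerre is the case \<open>c = 1\<close>, \<open>z = -1\<close>.
\<close>

locale sobolev_system =
  fixes L :: "real poly \<Rightarrow> real" and D :: "real poly \<Rightarrow> real poly"
    and b g :: "nat \<Rightarrow> real poly" and H :: "nat \<Rightarrow> real" and \<beta> c z H0 lam :: real
  assumes linear_L: "linear_functional L"
    and D_add: "D (f1 + f2) = D f1 + D f2" and D_smult: "D (smult a f1) = smult a (D f1)"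
    and D_0: "D (b 0) = 0" and D_Suc: "D (b (Suc n)) = smult z (b n)"
    and degree_b: "degree (b n) \<le> n" and coeff_b: "coeff (b n) n = z ^ n / fact n"
    and degree_g: "degree (g n) \<le> n" and coeff_g: "coeff (g n) n = 1"
    and moment: "L (b j * g i) = (-1) ^ j / fact j * pochhammer \<beta> (i + j) * H i"
    and H: "(- z) ^ n * H n = H0 / c ^ n"
    and pos: "\<beta> > 0" "c > 0" "H0 > 0" "lam \<ge> 0" and z: "z \<noteq> 0"
begin

abbreviation "m \<equiv> hyp_poly b \<beta>"
abbreviation "p \<equiv> hyp_poly b (\<beta> - 1)"
abbreviation "ip f1 f2 \<equiv> L (f1 * f2) + lam * L (D f1 * D f2)"
abbreviation "q \<equiv> meixner_q \<beta> c (1 + lam * z\<^sup>2)"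
text \<open>The value of \<open>L (m n * m n)\<close>, as \<open>L_m_m\<close> shows.\<close>

definition h :: "nat \<Rightarrow> real" where "h n = pochhammer \<beta> n / fact n * H0 / c ^ n"

lemma h_pos: "h n > 0"
  using pos by (simp add: h_def pochhammer_pos)

lemma q_pos: "q n > 0"
  using meixner_q_mono[of \<beta> c "1 + lam * z\<^sup>2" n] pos by simp

lemma D_sum: "D (\<Sum>i\<in>I. F i) = (\<Sum>i\<in>I. D (F i))"
proof -
  have "D 0 = 0" using D_smult[of 0 0] by simp
  then show ?thesis
    by (induction I rule: infinite_finite_induct) (simp_all add: D_add)
qed

lemma degree_hyp_poly: "degree (hyp_poly b \<gamma> n) \<le> n"
  unfolding hyp_poly_def
  by (intro degree_sum_le order.trans[OF degree_smult_le] order.trans[OF degree_b]) auto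

lemma coeff_hyp_poly: "coeff (hyp_poly b \<gamma> n) n = z ^ n / fact n"
proof -
  have "coeff (hyp_poly b \<gamma> n) n =
     (\<Sum>j\<le>n. if j = n then z ^ n / fact n else 0)"
    unfolding hyp_poly_def coeff_sum
    by (intro sum.cong refl) (use degree_b in \<open>auto simp: coeff_b intro!: coeff_eq_0 le_less_trans[OF degree_b]\<close>)
  then show ?thesis by simp
qed

text \<open>Inserting the moments and collecting the rising factorials leaves an \<open>n\<close>-th
  finite difference of \<open>pochhammer (\<beta> + real j) i\<close> in \<open>j\<close>, which is
  zero for \<open>i < n\<close>.\<close>

lemma L_m_g:
  assumes "i \<le> n"
  shows "L (m n * g i) = (if i = n then (-1) ^ n * pochhammer \<beta> n * H n else 0)"
proof -
  have "L (m n * g i) =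
     (\<Sum>j\<le>n. pochhammer (\<beta> + real j) (n - j) / fact (n - j) *
        ((-1) ^ j / fact j * pochhammer \<beta> (i + j) * H i))"
    by (simp add: hyp_poly_def sum_distrib_right linear_functionalD[OF linear_L] moment)
  \<comment> \<open>Splitting \<open>pochhammer \<beta> j\<close> off the moment completes
    \<open>pochhammer (\<beta> + real j) (n - j)\<close> to \<open>pochhammer \<beta> n\<close>,
    which no longer depends on \<open>j\<close>.\<close>
  also have "\<dots> = (\<Sum>j\<le>n. pochhammer \<beta> n * H i / fact n *
      ((-1) ^ j * real (n choose j) * pochhammer (\<beta> + real j) i))"
  proof (intro sum.cong refl)
    fix j assume "j \<in> {..n}"
    then have "j \<le> n" by simp
    then have 1: "pochhammer \<beta> n = pochhammer \<beta> j * pochhammer (\<beta> + real j) (n - j)"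
      by (rule pochhammer_product)
    have 2: "pochhammer \<beta> (i + j) = pochhammer \<beta> j * pochhammer (\<beta> + real j) i"
      by (simp add: pochhammer_product'[symmetric] add.commute)
    have 3: "real (n choose j) = fact n / (fact j * fact (n - j))"
      using \<open>j \<le> n\<close> by (rule binomial_fact)
    show "pochhammer (\<beta> + real j) (n - j) / fact (n - j) *
        ((-1) ^ j / fact j * pochhammer \<beta> (i + j) * H i) = pochhammer \<beta> n * H i / fact n *
      ((-1) ^ j * real (n choose j) * pochhammer (\<beta> + real j) i)"
      unfolding 1 2 3 by (simp add: field_simps)
  qed
  also have "\<dots> = pochhammer \<beta> n * H i / fact n * (if i = n then (-1) ^ n * fact n else 0)"
    unfolding sum_distrib_left[symmetric] alternating_binomial_sum_pochhammer[OF assms] ..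
  finally show ?thesis by simp
qed

lemma L_m:
  assumes "degree f \<le> n"
  shows "L (m n * f) = coeff f n * ((-1) ^ n * pochhammer \<beta> n * H n)"
proof -
  have "linear_functional (\<lambda>f. L (m n * f))"
    by (simp add: linear_functional_def algebra_simps linear_functionalD[OF linear_L])
  from linear_functional_triangular[OF this, of g n f] show ?thesis
    using assms degree_g coeff_g by (simp add: L_m_g)
qed

lemma L_m_m: "L (m n * m k) = (if n = k then h n else 0)"
proof -
  have less: "L (m n * m k) = 0" if "k < n" for n k
    using L_m[of "m k" n] degree_hyp_poly[of \<beta> k] that by (simp add: coeff_eq_0)
  have "(-z) ^ n * (pochhammer \<beta> n / fact n * H n) = h n"
    using H[of n] by (simp add: h_def mult.left_commute)
  moreover have "(-z) ^ n = (-1) ^ n * z ^ n"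
    by (rule power_minus)
  ultimately have "L (m n * m n) = h n"
    by (simp add: L_m degree_hyp_poly coeff_hyp_poly mult_ac)
  then show ?thesis
    using less[of n k] less[of k n] by (cases n k rule: linorder_cases) (simp_all add: mult.commute)
qed

lemma p_0: "p 0 = m 0"
  by (simp add: hyp_poly_def)

section \<open>The tridiagonal Sobolev Gram matrix\<close>

lemma D_p_0: "D (p 0) = 0"
  by (simp add: hyp_poly_def D_0)

text \<open>Passing from \<open>b (Suc j)\<close> to \<open>b j\<close> shifts the index by one,
  which exactly compensates the parameter lowered by one:
  \<open>\<beta> - 1 + (j + 1) = \<beta> + j\<close>.\<close>

lemma D_p_Suc: "D (p (Suc n)) = smult z (m n)"
  unfolding hyp_poly_def sum.atMost_Suc_shift
  by (simp add: D_add D_sum D_smult D_0 D_Suc smult_sum_right algebra_simps)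

lemma ip_p_0_0: "ip (p 0) (p 0) = h 0"
  unfolding p_0[symmetric] D_p_0 using L_m_m[of 0 0] by (simp add: p_0 linear_functionalD[OF linear_L])

lemma ip_p_0_Suc: "ip (p 0) (p (Suc k)) = (if k = 0 then - h 0 else 0)"
  unfolding D_p_0 unfolding hyp_poly_diff p_0
  by (simp add: algebra_simps linear_functionalD[OF linear_L] L_m_m)

text \<open>Writing \<open>p (Suc n)\<close> as \<open>m (Suc n) - m n\<close> gives the tridiagonal
  part; the \<open>D\<close> term involves only \<open>m n\<close> and \<open>m k\<close>, so it
  adds \<open>lam * z\<^sup>2 * h n\<close> to the diagonal.\<close>

lemma ip_p_Suc_Suc: "ip (p (Suc n)) (p (Suc k)) =
   (if n = k then h (Suc n) + (1 + lam * z\<^sup>2) * h n else if n = Suc k then - h n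
    else if k = Suc n then - h k else 0)"
  unfolding D_p_Suc unfolding hyp_poly_diff
  by (simp add: algebra_simps linear_functionalD[OF linear_L] L_m_m power2_eq_square)

lemma ip_commute: "ip f1 f2 = ip f2 f1"
  by (simp add: mult.commute)

lemma linear_ip: "linear_functional (ip f)"
  by (simp add: linear_functional_def algebra_simps linear_functionalD[OF linear_L] D_add D_smult)

text \<open>The candidate for \<open>smult (q n) (S n)\<close>.\<close>

definition U :: "nat \<Rightarrow> real poly" where "U n = (\<Sum>k\<le>n. smult (q k) (p k))"

text \<open>The ratio \<open>h (Suc n) / h n\<close> equals
  \<open>(n + \<beta>) / (c * (n + 1))\<close>, which turns the recurrence of \<open>q\<close> into
  one whose coefficients are the Gram matrix entries.\<close>

lemma q_rec: "h (Suc n) * q (Suc (Suc n)) =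
    (h (Suc n) + (1 + lam * z\<^sup>2) * h n) * q (Suc n) - h n * q n"
proof -
  have "h (Suc n) * (c * real (Suc n)) = h n * (real (Suc n) + \<beta> - 1)"
    using pos by (simp add: h_def pochhammer_Suc divide_simps del: of_nat_Suc)
  moreover have d: "real (Suc n) + \<beta> - 1 > 0" "c * real (Suc n) > 0"
    using pos by simp_all
  ultimately have h: "h (Suc n) = h n * (real (Suc n) + \<beta> - 1) / (c * real (Suc n))"
    by (simp add: field_simps)
  define e where "e = real (Suc n) + \<beta> - 1"
  define d where "d = c * real (Suc n)"
  define \<eta> where "\<eta> = 1 + lam * z\<^sup>2"
  have "e > 0" "d > 0"
    using d by (auto simp: e_def d_def)
  have q: "q (Suc (Suc n)) = ((e + \<eta> * d) * q (Suc n) - d * q n) / e"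
    by (simp add: e_def d_def \<eta>_def algebra_simps)
  have "h n * e / d * (((e + \<eta> * d) * x - d * y) / e) = (h n * e / d + \<eta> * h n) * x - h n * y" for x y
    using \<open>e > 0\<close> \<open>d > 0\<close> by (simp add: divide_simps) (simp add: algebra_simps)
  then show ?thesis
    unfolding q unfolding h e_def[symmetric] d_def[symmetric] \<eta>_def[symmetric] by simp
qed

text \<open>By \<open>q_rec\<close> the Gram matrix annihilates the vector of all
  \<open>q k\<close>. Truncation at \<open>n\<close> leaves a defect only in row \<open>n\<close>,
  where the missing neighbour \<open>- q (Suc n) * h n\<close> reappears with the opposite
  sign.\<close>

lemma ip_U_p: "j \<le> n \<Longrightarrow> ip (p j) (U n) = (if j = n then q (Suc n) * h n else 0)"
proof -
  have U_Suc: "ip (p j) (U (Suc n)) = ip (p j) (U n) + q (Suc n) * ip (p j) (p (Suc n))" for j n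
    unfolding U_def using linear_functionalD(1,2)[OF linear_ip[of "p j"]] by simp
  \<comment> \<open>A row beyond \<open>n\<close> meets \<open>U n\<close> at most in its last
    summand, and only when it is the row next to it.\<close>
  have zero: "ip (p (Suc j)) (U n) = (if j = n then - q n * h n else 0)" if "j \<ge> n" for j n
    using that
  proof (induction n)
    case 0
    have "ip (p (Suc j)) (U 0) = ip (p 0) (p (Suc j))"
      unfolding U_def using ip_commute by simp
    then show ?case unfolding ip_p_0_Suc by simp
  next
    case (Suc n)
    then show ?case
      unfolding U_Suc ip_p_Suc_Suc by simp
  qed
  have diag: "ip (p n) (U n) = q (Suc n) * h n" for n
  proof (cases n)
    case 0
    then show ?thesis
      unfolding U_def using ip_p_0_0 by simp
  next
    case (Suc k)
    have "ip (p n) (U n) = h (Suc k) * q (Suc (Suc k))"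
      unfolding Suc U_Suc ip_p_Suc_Suc using zero[of k k] unfolding q_rec by (simp add: algebra_simps)
    then show ?thesis unfolding Suc by simp
  qed
  \<comment> \<open>The first summand after row \<open>j\<close> cancels the diagonal value; later
    summands are not neighbours of row \<open>j\<close> and add nothing.\<close>
  have off: "ip (p j) (U n) = 0" if "j < n" for j n
    using that
  proof (induction n)
    case (Suc n)
    show ?case
    proof (cases "j = n")
      case True
      show ?thesis
        unfolding U_Suc True diag
        by (cases n) (simp_all add: ip_p_0_Suc ip_p_Suc_Suc)
    next
      case False
      with Suc.prems have "j < n" by simp
      then obtain k where n: "n = Suc k" by (cases n) auto
      have "ip (p j) (p (Suc n)) = 0"
        using \<open>j < n\<close> unfolding n by (cases j) (simp_all only: ip_p_0_Suc ip_p_Suc_Suc, simp_all)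
      then show ?thesis
        unfolding U_Suc using Suc.IH[OF \<open>j < n\<close>] by simp
    qed
  qed simp
  show "j \<le> n \<Longrightarrow> ?thesis"
    using diag off by (cases "j = n") simp_all
qed

lemma ip_U: "degree f \<le> n \<Longrightarrow> ip (U n) f = coeff f n * (fact n / z ^ n * q (Suc n) * h n)"
  using linear_functional_triangular[OF linear_ip, of p n "U n" f] z
  by (simp add: degree_hyp_poly coeff_hyp_poly ip_U_p ip_commute[of "U n"] del: meixner_q.simps)

text \<open>Both sides have the same coefficient at \<open>n\<close>, so a nonzero difference
  \<open>V\<close> has degree below \<open>n\<close>, and it is orthogonal to everything of degree
  below \<open>n\<close>. Pairing \<open>V\<close> with \<open>U (degree V)\<close> yields a nonzero
  multiple of its leading coefficient by \<open>ip_U\<close>, a contradiction.\<close>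

theorem sobolev_connection:
  assumes S: "orthogonal_polys (\<lambda>f1 f2. ip f1 f2) (\<lambda>n. 1 / fact n * z ^ n) S"
  shows "smult (q n) (S n) = (\<Sum>k\<le>n. smult (q k) (p k))"
proof (rule ccontr)
  have deg: "degree (S k) = k" and lead: "coeff (S k) k = z ^ k / fact k"
    and orth: "i \<noteq> k \<Longrightarrow> ip (S i) (S k) = 0" for i k
    using S unfolding orthogonal_polys_def by (auto, metis)
  define V where "V = smult (q n) (S n) - U n"
  assume "\<not> ?thesis"
  then have V: "V \<noteq> 0"
    by (simp add: V_def U_def)
  have "degree (U n) \<le> n"
    unfolding U_def
    by (intro degree_sum_le order.trans[OF degree_smult_le] order.trans[OF degree_hyp_poly]) auto
  then have "degree V \<le> n"
    unfolding V_def using deg[of n] by (intro degree_diff_le) simp_all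
  moreover have "coeff (U n) n = q n * (z ^ n / fact n)"
  proof -
    have "coeff (U n) n = (\<Sum>k\<le>n. if k = n then q n * (z ^ n / fact n) else 0)"
      unfolding U_def coeff_sum using degree_hyp_poly
      by (intro sum.cong refl) (auto simp: coeff_hyp_poly intro!: coeff_eq_0 le_less_trans[OF degree_hyp_poly])
    then show ?thesis by simp
  qed
  then have "coeff V n = 0"
    by (simp add: V_def lead)
  ultimately have less: "degree V < n"
    using V by (metis leading_coeff_0_iff le_neq_implies_less)
  have "ip (S n) f = 0" if "degree f < n" for f
    using linear_functional_triangular[OF linear_ip, of S n "S n" f] that deg lead orth z
    by (simp add: coeff_eq_0)
  moreover have "ip (U n) f = 0" if "degree f < n" for f
    using ip_U[of f n] that by (simp add: coeff_eq_0)
  ultimately have "ip f V = 0" if "degree f < n" for f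
    unfolding V_def linear_functionalD[OF linear_ip] using that by (simp add: ip_commute[of f])
  moreover have "degree (U (degree V)) \<le> degree V"
    unfolding U_def
    by (intro degree_sum_le order.trans[OF degree_smult_le] order.trans[OF degree_hyp_poly]) auto
  ultimately have "ip (U (degree V)) V = 0"
    using less by simp
  then have "coeff V (degree V) * (fact (degree V) / z ^ degree V * q (Suc (degree V)) * h (degree V)) = 0"
    using ip_U[of V "degree V"] by simp
  then show False
    using V z q_pos[of "Suc (degree V)"] h_pos[of "degree V"] by simp
qed

end

section \<open>Meixner and Laguerre functionals\<close>

text \<open>Newton's binomial series with exponent \<open>-a\<close>, evaluated at
  \<open>-s\<close>.\<close>

lemma pochhammer_series:
  fixes a s :: real
  assumes "\<bar>s\<bar> < 1"
  shows "(\<lambda>n. pochhammer a n / fact n * s ^ n) sums (1 - s) powr (- a)"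
proof -
  have "(-a gchoose n) * (-s) ^ n = pochhammer a n / fact n * s ^ n" for n
    by (simp add: gbinomial_pochhammer power_minus[of s] mult.commute mult.left_commute)
  then show ?thesis
    using gen_binomial_real[of "-s" "-a"] assms by simp
qed

lemma prod_linear_monic:
  fixes a :: "nat \<Rightarrow> real"
  shows "degree (\<Prod>i<n. [:a i, 1:]) = n" "coeff (\<Prod>i<n. [:a i, 1:]) n = 1"
proof -
  show deg: "degree (\<Prod>i<n. [:a i, 1:]) = n"
    by (subst degree_prod_eq_sum_degree) auto
  have "lead_coeff (\<Prod>i<n. [:a i, 1:]) = 1"
    by (simp add: lead_coeff_prod)
  then show "coeff (\<Prod>i<n. [:a i, 1:]) n = 1"
    unfolding deg .
qed

section \<open>The Meixner functional and its moments\<close>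

definition meixner_functional :: "real \<Rightarrow> real \<Rightarrow> real poly \<Rightarrow> real" where
  "meixner_functional \<beta> c f = (\<Sum>k. poly f (real k) * meixner_weight \<beta> c k)"

definition poly_diff :: "real poly \<Rightarrow> real poly" where
  "poly_diff f = pcompose f [:1, 1:] - f"

definition meixner_basis :: "real \<Rightarrow> nat \<Rightarrow> real poly" where
  "meixner_basis c j = smult ((1 - 1 / c) ^ j / fact j) (\<Prod>i<j. [:- real i, 1:])"

definition rising_poly :: "real \<Rightarrow> nat \<Rightarrow> real poly" where
  "rising_poly \<beta> n = (\<Prod>i<n. [:\<beta> + real i, 1:])"

lemma poly_poly_diff: "poly (poly_diff f) x = forward_diff (poly f) x"
  by (simp add: poly_diff_def forward_diff_def poly_pcompose add.commute)

lemma poly_meixner_basis: "poly (meixner_basis c j) x = (1 - 1 / c) ^ j * (x gchoose j)"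
  by (simp add: meixner_basis_def poly_prod gbinomial_prod_rev lessThan_atLeast0)

lemma poly_rising_poly: "poly (rising_poly \<beta> n) x = pochhammer (\<beta> + x) n"
  by (simp add: rising_poly_def poly_prod pochhammer_prod lessThan_atLeast0 add_ac)

lemma poly_diff_meixner_basis:
  "poly_diff (meixner_basis c (Suc n)) = smult (1 - 1 / c) (meixner_basis c n)"
  by (simp add: poly_eq_poly_eq_iff[symmetric] fun_eq_iff poly_poly_diff forward_diff_def
      poly_meixner_basis gbinomial_Suc_Suc distrib_left)

text \<open>The generalized binomial kills all terms with \<open>k < j\<close>. After the shift
  \<open>k = l + j\<close> the rising factorials merge, and a binomial series with exponent
  \<open>- (\<beta> + i + j)\<close> remains.\<close>

lemma meixner_moment_sums:
  assumes "0 < c" "c < 1"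
  shows "(\<lambda>k. poly (meixner_basis c j * rising_poly \<beta> i) (real k) * meixner_weight \<beta> c k) sums
     ((-1) ^ j / fact j * pochhammer \<beta> (i + j) * (1 - c) powr (- \<beta> - real i))"
    (is "?f sums ?s")
proof -
  define y where "y = (1 - 1 / c) ^ j * c ^ j / fact j * pochhammer \<beta> (i + j)"
  have "?f (l + j) = y * (pochhammer (\<beta> + real (i + j)) l / fact l * c ^ l)" for l
  proof -
    have "pochhammer \<beta> (l + j) * pochhammer (\<beta> + real (l + j)) i =
        pochhammer \<beta> (i + j) * pochhammer (\<beta> + real (i + j)) l"
      unfolding pochhammer_product'[symmetric] by (simp add: add_ac)
    moreover have "real (l + j) gchoose j = fact (l + j) / (fact j * fact l)"
      using binomial_fact[of j "l + j", where 'a = real]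
      by (simp add: binomial_gbinomial[symmetric] del: of_nat_add)
    ultimately show ?thesis
      by (simp add: y_def poly_meixner_basis poly_rising_poly meixner_weight_def power_add field_simps)
  qed
  moreover have "(\<lambda>l. y * (pochhammer (\<beta> + real (i + j)) l / fact l * c ^ l)) sums
      (y * (1 - c) powr (- (\<beta> + real (i + j))))"
    using assms by (intro sums_mult pochhammer_series) auto
  \<comment> \<open>The prefactor supplies \<open>(1 - c) ^ j\<close>, which removes
    \<open>j\<close> from the exponent.\<close>
  moreover have "y * (1 - c) powr (- (\<beta> + real (i + j))) = ?s"
  proof -
    have "(1 - 1 / c) ^ j * c ^ j = (-1) ^ j * (1 - c) ^ j"
      using assms by (simp add: power_mult_distrib[symmetric] algebra_simps)
    moreover have "(1 - c) ^ j * (1 - c) powr (- (\<beta> + real (i + j))) = (1 - c) powr (- \<beta> - real i)"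
      using assms by (simp add: powr_realpow[symmetric] powr_add[symmetric] minus_diff_commute)
    ultimately show ?thesis
      by (simp add: y_def mult_ac)
  qed
  ultimately have "(\<lambda>l. ?f (l + j)) sums ?s"
    by simp
  moreover have "?f k = 0" if "k < j" for k
    using that by (simp add: poly_meixner_basis binomial_gbinomial[symmetric])
  ultimately show ?thesis
    using sums_zero_iff_shift[of j ?f ?s] by simp
qed

text \<open>The case \<open>j = 0\<close> of the moment series covers the rising factorials, which
  span all polynomials. Summability is what makes \<open>meixner_functional\<close> linear.\<close>

lemma summable_meixner:
  assumes "0 < c" "c < 1"
  shows "summable (\<lambda>k. poly f (real k) * meixner_weight \<beta> c k)"
proof (rule poly_triangular_span[where P = "\<lambda>f. summable (\<lambda>k. poly f (real k) * meixner_weight \<beta> c k)"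
        and e = "rising_poly \<beta>" and n = "Suc (degree f)"])
  show "summable (\<lambda>k. poly (rising_poly \<beta> j) (real k) * meixner_weight \<beta> c k)" for j
    using sums_summable[OF meixner_moment_sums[OF assms, of 0]] by (simp add: poly_meixner_basis)
  show "summable (\<lambda>k. poly (smult a f) (real k) * meixner_weight \<beta> c k)"
    if "summable (\<lambda>k. poly f (real k) * meixner_weight \<beta> c k)" for a f
    using summable_mult[OF that, of a] by (simp add: mult.assoc)
qed (simp_all add: rising_poly_def prod_linear_monic coeff_eq_0 distrib_right summable_add)

lemma meixner_sobolev_system:
  assumes "0 < c" "c < 1" "\<beta> > 0" "lam \<ge> 0"
  shows "sobolev_system (meixner_functional \<beta> c) poly_diff (meixner_basis c) (rising_poly \<beta>)
    (\<lambda>n. (1 - c) powr (- \<beta> - real n)) \<beta> c (1 - 1 / c) ((1 - c) powr - \<beta>) lam"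
proof
  note summable = summable_meixner[OF assms(1,2), of _ \<beta>]
  show "linear_functional (meixner_functional \<beta> c)"
    unfolding linear_functional_def meixner_functional_def
    using suminf_add[OF summable summable] suminf_mult[OF summable]
    by (auto simp: distrib_right mult.assoc)
  show "meixner_functional \<beta> c (meixner_basis c j * rising_poly \<beta> i) =
      (-1) ^ j / fact j * pochhammer \<beta> (i + j) * (1 - c) powr (- \<beta> - real i)" for i j
    unfolding meixner_functional_def
    using sums_unique[OF meixner_moment_sums[OF assms(1,2)]] by simp
  show "(- (1 - 1 / c)) ^ n * (1 - c) powr (- \<beta> - real n) = (1 - c) powr - \<beta> / c ^ n" for n
  proof -
    have "- (1 - 1 / c) = (1 - c) / c"
      using assms by (simp add: field_simps)
    moreover have "(1 - c) ^ n * (1 - c) powr (- \<beta> - real n) = (1 - c) powr - \<beta>"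
      using assms by (simp add: powr_realpow[symmetric] powr_add[symmetric])
    ultimately show ?thesis
      by (simp add: power_divide)
  qed
  show "poly_diff (meixner_basis c (Suc n)) = smult (1 - 1 / c) (meixner_basis c n)" for n
    by (rule poly_diff_meixner_basis)
  show "poly_diff (meixner_basis c 0) = 0"
    by (simp add: poly_diff_def meixner_basis_def)
qed (use assms in \<open>auto simp: poly_diff_def pcompose_add pcompose_smult smult_diff_right
      rising_poly_def meixner_basis_def prod_linear_monic
      intro!: order.trans[OF degree_smult_le]\<close>)

theorem meixner_connection:
  assumes "0 < c" "c < 1" "\<beta> > 0" "lam \<ge> 0" "is_meixner_sobolev \<beta> c lam S"
  defines "q \<equiv> meixner_q \<beta> c (meixner_eta c lam)"
  shows "smult (q n) (S n) = (\<Sum>k\<le>n. smult (q k) (hyp_poly (meixner_basis c) (\<beta> - 1) k))"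
proof -
  interpret sobolev_system "meixner_functional \<beta> c" poly_diff "meixner_basis c" "rising_poly \<beta>"
    "\<lambda>n. (1 - c) powr (- \<beta> - real n)" \<beta> c "1 - 1 / c" "(1 - c) powr - \<beta>" lam
    by (rule meixner_sobolev_system) fact+
  have "meixner_sobolev_ip \<beta> c lam = (\<lambda>f1 f2. meixner_functional \<beta> c (f1 * f2) +
      lam * meixner_functional \<beta> c (poly_diff f1 * poly_diff f2))"
    by (simp add: fun_eq_iff meixner_sobolev_ip_def meixner_functional_def poly_poly_diff)
  then show ?thesis
    using sobolev_connection[of S n] assms(5)
    by (simp add: is_meixner_sobolev_def q_def meixner_eta_def)
qed

section \<open>The Laguerre functional and its moments\<close>

definition laguerre_functional :: "real \<Rightarrow> real poly \<Rightarrow> real" where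
  "laguerre_functional \<alpha> f = (LBINT x:{0<..}. poly f x * x powr \<alpha> * exp (- x))"

definition laguerre_basis :: "nat \<Rightarrow> real poly" where
  "laguerre_basis j = monom ((-1) ^ j / fact j) j"

lemma has_bochner_integral_Gamma:
  fixes \<alpha> :: real
  assumes "\<alpha> > -1"
  shows "has_bochner_integral lborel (\<lambda>x. indicator {0<..} x * (x powr \<alpha> * exp (- x))) (Gamma (\<alpha> + 1))"
proof (rule has_bochner_integral_nn_integral)
  have "(\<integral>\<^sup>+ x. ennreal (indicator {0<..} x * (x powr \<alpha> * exp (- x))) \<partial>lborel) =
     (\<integral>\<^sup>+ x. ennreal (indicator {0..} x * x powr (\<alpha> + 1 - 1) / exp x) \<partial>lborel)"
    \<comment> \<open>The half-lines differ only in the point 0, where the integrand vanishes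
      because \<open>0 powr y = 0\<close>.\<close>
    by (intro nn_integral_cong) (auto simp: indicator_def exp_minus field_simps)
  also have "\<dots> = ennreal (Gamma (\<alpha> + 1))"
    using Gamma_conv_nn_integral_real[of "\<alpha> + 1"] assms by simp
  finally show "(\<integral>\<^sup>+ x. ennreal (indicator {0<..} x * (x powr \<alpha> * exp (- x))) \<partial>lborel) = ennreal (Gamma (\<alpha> + 1))" .
qed (use assms in \<open>auto simp: Gamma_real_pos less_imp_le\<close>)

lemma laguerre_moment:
  fixes \<alpha> :: real
  assumes "\<alpha> > -1"
  shows "set_integrable lborel {0<..} (\<lambda>x. poly (monom 1 n) x * x powr \<alpha> * exp (- x))"
    and "laguerre_functional \<alpha> (monom 1 n) = pochhammer (\<alpha> + 1) n * Gamma (\<alpha> + 1)"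
proof -
  have "has_bochner_integral lborel
      (\<lambda>x. indicator {0<..} x *\<^sub>R (poly (monom 1 n) x * x powr \<alpha> * exp (- x))) (Gamma (\<alpha> + real n + 1))"
  proof -
    have "(\<lambda>x. indicator {0<..} x * (x powr (\<alpha> + real n) * exp (- x))) =
      (\<lambda>x. indicator {0<..} x *\<^sub>R (poly (monom 1 n) x * x powr \<alpha> * exp (- x)))"
      by (auto simp: fun_eq_iff indicator_def poly_monom powr_add powr_realpow)
    then show ?thesis
      using has_bochner_integral_Gamma[of "\<alpha> + real n"] assms by simp
  qed
  moreover have "pochhammer (\<alpha> + 1) n * Gamma (\<alpha> + 1) = Gamma (\<alpha> + real n + 1)"
  proof -
    have "\<alpha> + 1 \<notin> \<int>\<^sub>\<le>\<^sub>0"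
      using assms by (auto elim!: nonpos_Ints_cases)
    moreover have "Gamma (\<alpha> + 1) \<noteq> 0"
      using assms Gamma_real_pos[of "\<alpha> + 1"] by linarith
    ultimately show ?thesis
      using pochhammer_Gamma[of "\<alpha> + 1" n] by (simp add: add_ac)
  qed
  ultimately show "set_integrable lborel {0<..} (\<lambda>x. poly (monom 1 n) x * x powr \<alpha> * exp (- x))"
    and "laguerre_functional \<alpha> (monom 1 n) = pochhammer (\<alpha> + 1) n * Gamma (\<alpha> + 1)"
    unfolding set_integrable_def laguerre_functional_def set_lebesgue_integral_def has_bochner_integral_iff
    by auto
qed

lemma set_integrable_laguerre:
  fixes f :: "real poly"
  assumes "\<alpha> > -1"
  shows "set_integrable lborel {0<..} (\<lambda>x. poly f x * x powr \<alpha> * exp (- x))"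
proof (rule poly_triangular_span[where
        P = "\<lambda>f. set_integrable lborel {0<..} (\<lambda>x. poly f x * x powr \<alpha> * exp (- x))"
        and e = "monom 1" and n = "Suc (degree f)"])
  show "set_integrable lborel {0<..} (\<lambda>x. poly (smult a f) x * x powr \<alpha> * exp (- x))"
    if "set_integrable lborel {0<..} (\<lambda>x. poly f x * x powr \<alpha> * exp (- x))" for a f
    using set_integrable_mult_right[of a, OF that] by (simp add: mult.assoc)
  show "set_integrable lborel {0<..} (\<lambda>x. poly (f + g) x * x powr \<alpha> * exp (- x))"
    if "set_integrable lborel {0<..} (\<lambda>x. poly f x * x powr \<alpha> * exp (- x))"
      "set_integrable lborel {0<..} (\<lambda>x. poly g x * x powr \<alpha> * exp (- x))" for f g
    using set_integral_add(1)[OF that] by (simp add: distrib_right)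
  show "set_integrable lborel {0<..} (\<lambda>x. poly 0 x * x powr \<alpha> * exp (- x))"
    by (simp add: set_integrable_def)
qed (auto simp: laguerre_moment(1)[OF assms] degree_monom_eq coeff_eq_0)

lemma laguerre_sobolev_system:
  assumes "\<alpha> > -1" "lam \<ge> 0"
  shows "sobolev_system (laguerre_functional \<alpha>) pderiv laguerre_basis (monom 1)
    (\<lambda>n. Gamma (\<alpha> + 1)) (\<alpha> + 1) 1 (-1) (Gamma (\<alpha> + 1)) lam"
proof
  note int = set_integrable_laguerre[OF assms(1)]
  show linear: "linear_functional (laguerre_functional \<alpha>)"
    unfolding linear_functional_def laguerre_functional_def
    using set_integral_add(2)[OF int int] by (simp add: distrib_right mult.assoc)
  show "laguerre_functional \<alpha> (laguerre_basis j * monom 1 i) =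
      (-1) ^ j / fact j * pochhammer (\<alpha> + 1) (i + j) * Gamma (\<alpha> + 1)" for i j
  proof -
    have "laguerre_basis j * monom 1 i = smult ((-1) ^ j / fact j) (monom 1 (i + j))"
      by (simp add: laguerre_basis_def mult_monom smult_monom add.commute)
    then show ?thesis
      using laguerre_moment(2)[OF assms(1)] by (simp add: linear_functionalD[OF linear])
  qed
  show "pderiv (laguerre_basis (Suc n)) = smult (-1) (laguerre_basis n)" for n
    by (simp add: laguerre_basis_def pderiv_monom smult_monom field_simps del: of_nat_Suc)
qed (use assms in \<open>auto simp: laguerre_basis_def pderiv_add pderiv_smult pderiv_monom degree_monom_le Gamma_real_pos\<close>)

text \<open>At \<open>c = 1\<close> the two recurrences coincide, so continuity of
  \<open>meixner_q\<close> in \<open>c\<close> also gives the limit of the coefficients.\<close>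

lemma laguerre_q_eq: "laguerre_q \<alpha> lam n = meixner_q (\<alpha> + 1) 1 (1 + lam) n"
  by (induction \<alpha> lam n rule: laguerre_q.induct) (simp_all add: algebra_simps)

theorem laguerre_connection:
  assumes "\<alpha> > -1" "lam \<ge> 0" "is_laguerre_sobolev \<alpha> lam S"
  defines "q \<equiv> laguerre_q \<alpha> lam"
  shows "smult (q n) (S n) = (\<Sum>k\<le>n. smult (q k) (hyp_poly laguerre_basis \<alpha> k))"
proof -
  interpret sobolev_system "laguerre_functional \<alpha>" pderiv laguerre_basis "monom 1"
    "\<lambda>n. Gamma (\<alpha> + 1)" "\<alpha> + 1" 1 "-1" "Gamma (\<alpha> + 1)" lam
    by (rule laguerre_sobolev_system) fact+
  have "laguerre_sobolev_ip \<alpha> lam = (\<lambda>f1 f2. laguerre_functional \<alpha> (f1 * f2) +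
      lam * laguerre_functional \<alpha> (pderiv f1 * pderiv f2))"
    by (simp add: fun_eq_iff laguerre_sobolev_ip_def laguerre_functional_def)
  then show ?thesis
    using sobolev_connection[of S n] assms(3)
    by (simp add: is_laguerre_sobolev_def q_def laguerre_q_eq)
qed

section \<open>Uniform bounds as \<open>c\<close> tends to 1\<close>

lemma cpoly_simps:
  "cpoly 0 y = 0"
  "cpoly (p + q) y = cpoly p y + cpoly q y"
  "cpoly (smult a p) y = of_real a * cpoly p y"
  "cpoly (pCons a p) y = of_real a + y * cpoly p y"
proof -
  show "cpoly 0 y = 0" "cpoly (pCons a p) y = of_real a + y * cpoly p y"
    by (simp_all add: map_poly_pCons)
  have "map_poly complex_of_real (p + q) = map_poly of_real p + map_poly of_real q"
    by (simp add: poly_eq_iff coeff_map_poly)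
  then show "cpoly (p + q) y = cpoly p y + cpoly q y"
    by simp
  have "map_poly complex_of_real (smult a p) = smult (of_real a) (map_poly of_real p)"
    by (simp add: poly_eq_iff coeff_map_poly)
  then show "cpoly (smult a p) y = of_real a * cpoly p y"
    by simp
qed

lemma cpoly_sum: "cpoly (\<Sum>i\<in>I. F i) y = (\<Sum>i\<in>I. cpoly (F i) y)"
  by (induction I rule: infinite_finite_induct) (simp_all add: cpoly_simps)

lemma cpoly_prod_linear:
  fixes a :: "nat \<Rightarrow> real"
  shows "cpoly (\<Prod>i<n. [:a i, 1:]) y = (\<Prod>i<n. y + of_real (a i))"
proof (induction n)
  case (Suc n)
  have "(\<Prod>i<Suc n. [:a i, 1:]) =
      smult (a n) (\<Prod>i<n. [:a i, 1:]) + pCons 0 (\<Prod>i<n. [:a i, 1:])"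
    by (simp add: mult.commute)
  then have "cpoly (\<Prod>i<Suc n. [:a i, 1:]) y =
      of_real (a n) * cpoly (\<Prod>i<n. [:a i, 1:]) y + y * cpoly (\<Prod>i<n. [:a i, 1:]) y"
    by (simp only: cpoly_simps of_real_0 add_0_left)
  then show ?case
    by (simp add: Suc algebra_simps)
qed simp

text \<open>
  With \<open>t = 1 - c\<close>, \<open>scaled_hyp\<close> is \<open>c\<^sup>k\<close> times the Meixner polynomial at \<open>x / (1 - c)\<close>, written
  so that \<open>t = 0\<close> makes sense and gives the Laguerre polynomial.
\<close>

definition scaled_basis :: "complex \<Rightarrow> real \<Rightarrow> nat \<Rightarrow> complex" where
  "scaled_basis x t j = (-1) ^ j / fact j * (\<Prod>i<j. x - of_real (real i * t))"

definition scaled_hyp :: "real \<Rightarrow> complex \<Rightarrow> real \<Rightarrow> nat \<Rightarrow> complex" where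
  "scaled_hyp \<alpha> x t k = (\<Sum>j\<le>k. of_real (pochhammer (\<alpha> + real j) (k - j) / fact (k - j) * (1 - t) ^ (k - j))
      * scaled_basis x t j)"

text \<open>Each factor \<open>x / (1 - c) - i\<close> is
  \<open>(x - i * (1 - c)) / (1 - c)\<close>, and the resulting powers of \<open>1 - c\<close>
  cancel against \<open>c ^ j * (1 - 1 / c) ^ j = (-1) ^ j * (1 - c) ^ j\<close>.\<close>

lemma cpoly_meixner_basis:
  assumes "0 < c" "c < 1"
  shows "of_real (c ^ j) * cpoly (meixner_basis c j) (x / of_real (1 - c)) = scaled_basis x (1 - c) j"
proof -
  have c: "complex_of_real (1 - c) \<noteq> 0"
    using assms by (metis diff_gt_0_iff_gt less_irrefl of_real_eq_0_iff)
  have "(\<Prod>i<j. x / of_real (1 - c) + of_real (- real i)) =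
     (\<Prod>i<j. (x - of_real (real i * (1 - c))) / of_real (1 - c))"
    using c by (intro prod.cong refl) (simp add: field_simps)
  also have "\<dots> = (\<Prod>i<j. x - of_real (real i * (1 - c))) / of_real (1 - c) ^ j"
    by (simp add: prod_dividef)
  finally have "cpoly (meixner_basis c j) (x / of_real (1 - c)) =
     of_real ((1 - 1 / c) ^ j / fact j) * ((\<Prod>i<j. x - of_real (real i * (1 - c))) / of_real (1 - c) ^ j)"
    by (simp only: meixner_basis_def cpoly_simps cpoly_prod_linear)
  moreover have "of_real (c ^ j) * (of_real ((1 - 1 / c) ^ j / fact j) * (y / of_real (1 - c) ^ j)) =
     (-1) ^ j / fact j * y" for y :: complex
  proof -
    have "c ^ j * (1 - 1 / c) ^ j = (-1) ^ j * (1 - c) ^ j"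
      using assms by (simp add: power_mult_distrib[symmetric] algebra_simps)
    then have "complex_of_real (c ^ j * (1 - 1 / c) ^ j) = (-1) ^ j * of_real (1 - c) ^ j"
      by simp
    then have "of_real (c ^ j) * of_real ((1 - 1 / c) ^ j) = (-1) ^ j * complex_of_real (1 - c) ^ j"
      by (simp only: of_real_mult)
    moreover have "complex_of_real (1 - c) ^ j \<noteq> 0"
      using c by (simp only: power_not_zero not_False_eq_True)
    moreover have "e * (f / g * (y / d)) = s / g * y" if "e * f = s * d" "d \<noteq> 0" for d e f g s :: complex
      using that by (metis (no_types) mult.assoc mult.commute nonzero_mult_div_cancel_right times_divide_eq_left times_divide_eq_right)
    ultimately show ?thesis
      by (simp only: of_real_divide of_real_fact)
  qed
  ultimately show ?thesis
    by (simp only: scaled_basis_def)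
qed

lemma cpoly_laguerre_basis: "cpoly (laguerre_basis j) x = scaled_basis x 0 j"
proof -
  have "map_poly complex_of_real (monom a j) = monom (of_real a) j" for a
    by (simp add: poly_eq_iff coeff_map_poly)
  then show ?thesis
    by (simp add: laguerre_basis_def scaled_basis_def poly_monom)
qed

lemma cpoly_hyp_poly: "cpoly (hyp_poly b \<gamma> k) y =
    (\<Sum>j\<le>k. of_real (pochhammer (\<gamma> + real j) (k - j) / fact (k - j)) * cpoly (b j) y)"
  unfolding hyp_poly_def by (simp only: cpoly_sum cpoly_simps)

lemma cpoly_hyp_poly_meixner:
  assumes "0 < c" "c < 1"
  shows "of_real (c ^ k) * cpoly (hyp_poly (meixner_basis c) \<alpha> k) (x / of_real (1 - c)) =
    scaled_hyp \<alpha> x (1 - c) k"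
  unfolding cpoly_hyp_poly scaled_hyp_def sum_distrib_left
proof (intro sum.cong refl)
  fix j assume "j \<in> {..k}"
  then have "c ^ k = c ^ (k - j) * c ^ j"
    by (simp add: power_add[symmetric])
  then show "of_real (c ^ k) * (of_real (pochhammer (\<alpha> + real j) (k - j) / fact (k - j)) *
        cpoly (meixner_basis c j) (x / of_real (1 - c))) =
      of_real (pochhammer (\<alpha> + real j) (k - j) / fact (k - j) * (1 - (1 - c)) ^ (k - j)) *
        scaled_basis x (1 - c) j"
    unfolding cpoly_meixner_basis[OF assms, symmetric] by (simp add: mult_ac)
qed

lemma cpoly_hyp_poly_laguerre: "cpoly (hyp_poly laguerre_basis \<alpha> k) x = scaled_hyp \<alpha> x 0 k"
  unfolding cpoly_hyp_poly scaled_hyp_def cpoly_laguerre_basis by simp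

lemma tendsto_scaled_hyp:
  assumes "(f \<longlongrightarrow> t) F"
  shows "((\<lambda>c. scaled_hyp \<alpha> x (f c) k) \<longlongrightarrow> scaled_hyp \<alpha> x t k) F"
  unfolding scaled_hyp_def scaled_basis_def by (intro tendsto_intros assms) auto

text \<open>All terms of the binomial series are nonnegative here, so its sum dominates every
  partial sum and every single term.\<close>

lemma pochhammer_series_le:
  fixes a s :: real
  assumes "a \<ge> 0" "0 \<le> s" "s < 1"
  shows "(\<Sum>n\<le>N. pochhammer a n / fact n * s ^ n) \<le> (1 - s) powr (- a)"
    and "pochhammer a n / fact n * s ^ n \<le> (1 - s) powr (- a)"
proof -
  have s: "(\<lambda>n. pochhammer a n / fact n * s ^ n) sums (1 - s) powr (- a)"
    using assms by (intro pochhammer_series) auto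
  have nonneg: "pochhammer a n / fact n * s ^ n \<ge> 0" for n
    using assms by (intro mult_nonneg_nonneg divide_nonneg_nonneg) (auto simp: pochhammer_prod intro: prod_nonneg)
  show "(\<Sum>n\<le>N. pochhammer a n / fact n * s ^ n) \<le> (1 - s) powr (- a)" for N
    using sum_le_suminf[OF sums_summable[OF s], of "{..N}"] sums_unique[OF s] nonneg by simp
  show "pochhammer a n / fact n * s ^ n \<le> (1 - s) powr (- a)"
    using sum_le_suminf[OF sums_summable[OF s], of "{n}"] sums_unique[OF s] nonneg by simp
qed

lemma abs_pochhammer_le: "\<bar>pochhammer a n\<bar> \<le> pochhammer \<bar>a\<bar> n" for a :: real
  unfolding pochhammer_prod abs_prod by (intro prod_mono) auto

lemma pochhammer_mono: "0 \<le> a \<Longrightarrow> a \<le> b \<Longrightarrow> pochhammer a n \<le> pochhammer b n" for a b :: real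
  unfolding pochhammer_prod by (intro prod_mono) auto

text \<open>Each factor is at most \<open>norm x + i * \<delta>\<close>, that is
  \<open>\<delta>\<close> times a factor of a rising factorial. Using \<open>\<delta>\<close>
  instead of \<open>t\<close> makes the bound uniform and includes \<open>t = 0\<close>.\<close>

lemma norm_scaled_basis_le:
  assumes "0 \<le> t" "t \<le> \<delta>" "0 < \<delta>"
  shows "norm (scaled_basis x t j) \<le> pochhammer (norm x / \<delta>) j / fact j * \<delta> ^ j"
proof -
  have "norm (scaled_basis x t j) = (\<Prod>i<j. norm (x - of_real (real i * t))) / fact j"
    by (simp add: scaled_basis_def norm_mult norm_divide norm_power prod_norm)
  also have "\<dots> \<le> (\<Prod>i<j. (norm x / \<delta> + real i) * \<delta>) / fact j"
  proof (intro divide_right_mono prod_mono conjI)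
    fix i
    have "norm (x - of_real (real i * t)) \<le> norm x + real i * t"
      using norm_triangle_ineq4[of x "of_real (real i * t)"] assms(1) by (simp add: norm_mult)
    also have "\<dots> \<le> norm x + real i * \<delta>"
      using assms by (simp add: mult_left_mono)
    also have "\<dots> = (norm x / \<delta> + real i) * \<delta>"
      using assms by (simp add: field_simps)
    finally show "norm (x - of_real (real i * t)) \<le> (norm x / \<delta> + real i) * \<delta>" .
  qed auto
  also have "\<dots> = pochhammer (norm x / \<delta>) j / fact j * \<delta> ^ j"
    by (simp add: prod.distrib pochhammer_prod lessThan_atLeast0)
  finally show ?thesis .
qed

text \<open>After multiplication by \<open>\<tau> ^ k\<close>, split as
  \<open>\<tau> ^ (k - j) * \<tau> ^ j\<close>, two binomial series bound the sum: one at
  \<open>\<tau>\<close> for the coefficients, one at \<open>1 / 2\<close> for the basis. As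
  \<open>\<tau>\<close> may be close to 1, growth is subexponential, uniformly in
  \<open>t\<close>.\<close>

lemma scaled_hyp_bound:
  assumes "0 < \<tau>" "\<tau> < 1"
  shows "\<exists>K \<delta>. 0 < K \<and> 0 < \<delta> \<and> (\<forall>t k. 0 \<le> t \<longrightarrow> t \<le> \<delta> \<longrightarrow> t \<le> 1 \<longrightarrow>
    norm (scaled_hyp \<alpha> x t k) \<le> K / \<tau> ^ k)"
proof -
  \<comment> \<open>Chosen so that \<open>\<delta> * \<tau> / (1 - \<tau>)\<close> is
    \<open>1 / 2\<close>, the argument of the second binomial series; \<open>K\<close> is the
    product of the \<open>j\<close>-independent factor and its sum.\<close>
  define \<delta> where "\<delta> = (1 - \<tau>) / (2 * \<tau>)"
  define K where "K = (1 - \<tau>) powr (- \<bar>\<alpha>\<bar>) * (1 / 2) powr (- (norm x / \<delta>))"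
  have \<delta>: "\<delta> > 0" "\<delta> * \<tau> / (1 - \<tau>) = 1 / 2"
    using assms by (auto simp: \<delta>_def)
  have "norm (scaled_hyp \<alpha> x t k) \<le> K / \<tau> ^ k" if t: "0 \<le> t" "t \<le> \<delta>" "t \<le> 1" for t k
  proof -
    have "norm (scaled_hyp \<alpha> x t k) * \<tau> ^ k \<le>
       (\<Sum>j\<le>k. norm (of_real (pochhammer (\<alpha> + real j) (k - j) / fact (k - j) * (1 - t) ^ (k - j))
          * scaled_basis x t j)) * \<tau> ^ k"
      unfolding scaled_hyp_def using assms by (intro mult_right_mono norm_sum) auto
    also have "\<dots> \<le> (\<Sum>j\<le>k. (1 - \<tau>) powr (- \<bar>\<alpha>\<bar>) *
        (pochhammer (norm x / \<delta>) j / fact j * (1 / 2) ^ j))"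
      unfolding sum_distrib_right
    proof (intro sum_mono)
      fix j assume "j \<in> {..k}"
      define r where "r = k - j"
      have k: "\<tau> ^ k = \<tau> ^ r * \<tau> ^ j"
        using \<open>j \<in> {..k}\<close> by (simp add: r_def power_add[symmetric])
      have "\<bar>pochhammer (\<alpha> + real j) r\<bar> \<le> pochhammer (\<bar>\<alpha>\<bar> + real j) r"
        by (rule order.trans[OF abs_pochhammer_le pochhammer_mono]) auto
      moreover have "(1 - t) ^ r \<le> 1" "(1 - t) ^ r \<ge> 0"
        using t by (auto intro: power_le_one)
      ultimately have "\<bar>pochhammer (\<alpha> + real j) r\<bar> * (1 - t) ^ r \<le> pochhammer (\<bar>\<alpha>\<bar> + real j) r * 1"
        by (intro mult_mono) auto
      then have "\<bar>pochhammer (\<alpha> + real j) r\<bar> / fact r * (1 - t) ^ r * \<tau> ^ r \<le>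
          pochhammer (\<bar>\<alpha>\<bar> + real j) r / fact r * \<tau> ^ r"
        using assms by (simp add: divide_right_mono mult_right_mono)
      also have "\<dots> \<le> (1 - \<tau>) powr (- (\<bar>\<alpha>\<bar> + real j))"
        using assms by (intro pochhammer_series_le) auto
      also have "\<dots> = (1 - \<tau>) powr (- \<bar>\<alpha>\<bar>) / (1 - \<tau>) ^ j"
        using assms powr_diff[of "1 - \<tau>" "- \<bar>\<alpha>\<bar>" "real j"] by (simp add: powr_realpow)
      finally have 1: "\<bar>pochhammer (\<alpha> + real j) r\<bar> / fact r * (1 - t) ^ r * \<tau> ^ r \<le>
         (1 - \<tau>) powr (- \<bar>\<alpha>\<bar>) / (1 - \<tau>) ^ j" .
      have 2: "norm (scaled_basis x t j) * \<tau> ^ j \<le> pochhammer (norm x / \<delta>) j / fact j * \<delta> ^ j * \<tau> ^ j"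
        by (rule mult_right_mono[OF norm_scaled_basis_le[OF t(1,2) \<delta>(1)]]) (use assms in simp)
      have "norm (of_real (pochhammer (\<alpha> + real j) (k - j) / fact (k - j) * (1 - t) ^ (k - j))
          * scaled_basis x t j) * \<tau> ^ k =
        (\<bar>pochhammer (\<alpha> + real j) r\<bar> / fact r * (1 - t) ^ r * \<tau> ^ r) * (norm (scaled_basis x t j) * \<tau> ^ j)"
        unfolding k r_def[symmetric] norm_mult norm_of_real using t by (simp add: abs_mult mult_ac)
      also have "\<dots> \<le> ((1 - \<tau>) powr (- \<bar>\<alpha>\<bar>) / (1 - \<tau>) ^ j) * (pochhammer (norm x / \<delta>) j / fact j * \<delta> ^ j * \<tau> ^ j)"
        by (rule mult_mono[OF 1 2]) (use assms in auto)
      also have "\<dots> = (1 - \<tau>) powr (- \<bar>\<alpha>\<bar>) *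
          (pochhammer (norm x / \<delta>) j / fact j * (\<delta> * \<tau> / (1 - \<tau>)) ^ j)"
        by (simp add: power_mult_distrib power_divide mult_ac)
      finally show "norm (of_real (pochhammer (\<alpha> + real j) (k - j) / fact (k - j) * (1 - t) ^ (k - j))
          * scaled_basis x t j) * \<tau> ^ k \<le>
        (1 - \<tau>) powr (- \<bar>\<alpha>\<bar>) * (pochhammer (norm x / \<delta>) j / fact j * (1 / 2) ^ j)"
        unfolding \<delta>(2) .
    qed
    also have "\<dots> = (1 - \<tau>) powr (- \<bar>\<alpha>\<bar>) * (\<Sum>j\<le>k. pochhammer (norm x / \<delta>) j / fact j * (1 / 2) ^ j)"
      by (simp only: sum_distrib_left)
    also have "\<dots> \<le> K"
      unfolding K_def using pochhammer_series_le(1)[of "norm x / \<delta>" "1 / 2" k] \<delta>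
      by (intro mult_left_mono) auto
    finally show ?thesis
      using assms by (simp add: pos_le_divide_eq)
  qed
  moreover have "K > 0"
    using assms by (simp add: K_def)
  ultimately show ?thesis
    using \<delta>(1) by blast
qed


section \<open>Continuity and uniform growth of the coefficients\<close>

lemma tendsto_meixner_q:
  assumes "(f \<longlongrightarrow> c) F" "(g \<longlongrightarrow> \<eta>) F" "\<beta> > 0"
  shows "((\<lambda>y. meixner_q \<beta> (f y) (g y) n) \<longlongrightarrow> meixner_q \<beta> c \<eta> n) F"
proof (induction n rule: induct_nat_012)
  case (ge2 n)
  have "real (Suc n) + \<beta> - 1 \<noteq> 0"
    using assms(3) by simp
  then show ?case
    unfolding meixner_q.simps by (intro tendsto_intros assms ge2)
qed auto

text \<open>
  Since \<open>\<sigma> * w n \<le> u n\<close>, the quantity \<open>q (Suc n) - \<sigma> q n\<close> satisfies a first-order inequality with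
  factor \<open>w n\<close>. The condition says that \<open>\<sigma>\<close> does not lie strictly between the roots of the
  characteristic polynomial of the recurrence.
\<close>

lemma second_order_growth:
  fixes q u w :: "nat \<Rightarrow> real"
  assumes \<sigma>: "0 < \<sigma>" "\<sigma> < 1"
    and pos: "\<And>n. 0 < q n" and mono: "\<And>n. q n \<le> q (Suc n)"
    and rec: "\<And>n. n \<ge> N \<Longrightarrow> q (Suc (Suc n)) \<le> (w n + \<sigma>) * q (Suc n) - u n * q n"
    and w: "\<And>n. n \<ge> N \<Longrightarrow> 0 \<le> w n \<and> \<sigma> * w n \<le> u n \<and> w n \<le> 1 / \<sigma>"
    and M: "q (Suc N) \<le> M"
  shows "q n \<le> M * (1 + 1 / (1 / \<sigma> - \<sigma>)) * (1 / \<sigma>) ^ n"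
proof -
  define \<rho> where "\<rho> = 1 / \<sigma>"
  \<comment> \<open>Large enough for \<open>M + \<sigma> * C \<le> C * \<rho>\<close>, which closes
    the induction for \<open>tail\<close>, and for \<open>M \<le> C\<close>, which starts
    it.\<close>
  define C where "C = M * (1 + 1 / (\<rho> - \<sigma>))"
  have \<rho>: "\<rho> > 1"
    using \<sigma> by (simp add: \<rho>_def)
  have "M > 0"
    using pos[of "Suc N"] M by linarith
  have C: "M \<le> C * (\<rho> - \<sigma>)" "M \<le> C"
  proof -
    have "\<rho> - \<sigma> > 0"
      using \<rho> \<sigma> by simp
    moreover from this have "C * (\<rho> - \<sigma>) = M * (\<rho> - \<sigma>) + M"
      by (simp add: C_def distrib_left distrib_right)
    ultimately show "M \<le> C * (\<rho> - \<sigma>)" "M \<le> C"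
      using \<open>M > 0\<close> by (simp_all add: C_def distrib_left)
  qed
  have d: "q (Suc (N + m)) - \<sigma> * q (N + m) \<le> M * \<rho> ^ m" for m
  proof (induction m)
    case 0
    have "\<sigma> * q N \<ge> 0"
      using \<sigma> pos[of N] by simp
    then show ?case
      using M by simp
  next
    case (Suc m)
    define n where "n = N + m"
    have w: "0 \<le> w n" "\<sigma> * w n \<le> u n" "w n \<le> \<rho>"
      using w[of n] by (auto simp: n_def \<rho>_def)
    have "q (Suc (Suc n)) - \<sigma> * q (Suc n) \<le> w n * q (Suc n) - u n * q n"
      using rec[of n] by (simp add: n_def algebra_simps)
    also have "\<dots> \<le> w n * q (Suc n) - \<sigma> * w n * q n"
      using w(2) pos[of n] by (simp add: mult_right_mono)
    also have "\<dots> = w n * (q (Suc n) - \<sigma> * q n)"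
      by (simp add: algebra_simps)
    also have "\<dots> \<le> w n * (M * \<rho> ^ m)"
      using Suc w(1) by (intro mult_left_mono) (auto simp: n_def)
    also have "\<dots> \<le> \<rho> * (M * \<rho> ^ m)"
      using w(3) \<open>M > 0\<close> \<rho> by (intro mult_right_mono) auto
    finally show ?case
      by (simp add: n_def mult_ac)
  qed
  have tail: "q (N + m) \<le> C * \<rho> ^ m" for m
  proof (induction m)
    case 0
    show ?case
      using mono[of N] M C(2) by simp
  next
    case (Suc m)
    have "q (N + Suc m) \<le> M * \<rho> ^ m + \<sigma> * q (N + m)"
      using d[of m] by simp
    also have "\<dots> \<le> C * (\<rho> - \<sigma>) * \<rho> ^ m + \<sigma> * (C * \<rho> ^ m)"
      using C Suc \<sigma> \<rho> by (intro add_mono mult_right_mono mult_left_mono) auto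
    also have "\<dots> = C * \<rho> ^ Suc m"
      by (simp add: algebra_simps)
    finally show ?case .
  qed
  \<comment> \<open>Monotonicity also covers the indices below \<open>N\<close>, where the
    recurrence bound is not assumed.\<close>
  have "incseq q"
    using mono by (rule incseq_SucI)
  then have "q n \<le> q (N + n)"
    by (rule incseqD) simp
  also have "\<dots> \<le> C * \<rho> ^ n"
    by (rule tail)
  finally show ?thesis
    by (simp add: C_def \<rho>_def)
qed

text \<open>The bound on \<open>\<sigma>\<close> is the smaller root of
  \<open>t\<^sup>2 - (lam + 2) * t + 1\<close>, whose discriminant is
  \<open>lam\<^sup>2 + 4 * lam\<close>; the second claim says that this polynomial is positive at
  \<open>\<sigma>\<close>.\<close>

lemma below_small_root:
  fixes \<sigma> lam :: real
  assumes "lam > 0" "\<sigma> < (lam + 2 - sqrt (lam\<^sup>2 + 4 * lam)) / 2"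
  shows "\<sigma> < 1" "\<sigma> * (lam + 2 - \<sigma>) < 1"
proof -
  have "lam < sqrt (lam\<^sup>2 + 4 * lam)"
    using assms(1) by (intro real_less_rsqrt) simp
  then show "\<sigma> < 1"
    using assms(2) by simp
  have "sqrt (lam\<^sup>2 + 4 * lam) < lam + 2 - 2 * \<sigma>"
    using assms(2) by simp
  then have "(sqrt (lam\<^sup>2 + 4 * lam))\<^sup>2 < (lam + 2 - 2 * \<sigma>)\<^sup>2"
    using assms(1) by (intro power_strict_mono) auto
  then show "\<sigma> * (lam + 2 - \<sigma>) < 1"
    using assms(1) by (simp add: power2_eq_square algebra_simps)
qed

text \<open>The normalised coefficients converge jointly as \<open>n\<close> tends to infinity and
  \<open>c\<close> to 1, and the limits satisfy the conditions of \<open>second_order_growth\<close>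
  strictly. The product filter then provides one threshold \<open>N\<close> for all \<open>c\<close>
  near 1.\<close>

lemma eventually_meixner_q_le:
  assumes "\<alpha> > -1" "lam > 0" "0 < \<sigma>" "\<sigma> < (lam + 2 - sqrt (lam\<^sup>2 + 4 * lam)) / 2"
  shows "\<exists>C>0. \<forall>\<^sub>F c in at_left 1. \<forall>n. meixner_q (\<alpha> + 1) c (1 + lam / c\<^sup>2) n \<le> C * (1 / \<sigma>) ^ n"
proof -
  define u where "u = (\<lambda>(n::nat, c::real). c * (real (Suc n) / (real (Suc n) + \<alpha>)))"
  define w where "w = (\<lambda>(n, c). 1 + u (n, c) * (1 + lam / c\<^sup>2) - \<sigma>)"
  let ?F = "sequentially \<times>\<^sub>F at_left (1::real)"
  note \<sigma> = below_small_root[OF assms(2,4)]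
  have "(\<lambda>n. real (Suc n) / (real (Suc n) + \<alpha>)) \<longlonglongrightarrow> 1"
  proof -
    have "filterlim (\<lambda>n. \<alpha> + real (Suc n)) at_top sequentially"
      by (intro filterlim_tendsto_add_at_top[OF tendsto_const]
          filterlim_compose[OF filterlim_real_sequentially filterlim_Suc])
    then have "(\<lambda>n. 1 - \<alpha> / (\<alpha> + real (Suc n))) \<longlonglongrightarrow> 1 - 0"
      by (intro tendsto_diff tendsto_const real_tendsto_divide_at_top[OF tendsto_const])
    moreover have "1 - \<alpha> / (\<alpha> + real (Suc n)) = real (Suc n) / (real (Suc n) + \<alpha>)" for n
      using assms(1) by (simp add: field_simps)
    ultimately show ?thesis
      by simp
  qed
  then have u': "((\<lambda>y. snd y * (real (Suc (fst y)) / (real (Suc (fst y)) + \<alpha>))) \<longlongrightarrow> 1 * 1) ?F"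
    by (intro tendsto_mult filterlim_compose[OF _ filterlim_fst] filterlim_compose[OF _ filterlim_snd])
      (auto intro: tendsto_ident_at)
  then have u: "(u \<longlongrightarrow> 1) ?F"
    by (simp add: u_def case_prod_unfold)
  have "((\<lambda>y::nat \<times> real. snd y) \<longlongrightarrow> 1) ?F"
    by (intro filterlim_compose[OF _ filterlim_snd]) (auto intro: tendsto_ident_at)
  then have "((\<lambda>y. 1 + u y * (1 + lam / (snd y)\<^sup>2) - \<sigma>) \<longlongrightarrow> 1 + 1 * (1 + lam / 1\<^sup>2) - \<sigma>) ?F"
    by (intro tendsto_intros u) auto
  then have w: "(w \<longlongrightarrow> lam + 2 - \<sigma>) ?F"
    by (simp add: w_def case_prod_unfold add_ac)
  have "\<forall>\<^sub>F y in ?F. 0 < w y"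
    using w \<sigma> assms(2) by (intro order_tendstoD(1)[OF w]) auto
  moreover have "\<forall>\<^sub>F y in ?F. w y < 1 / \<sigma>"
    using \<sigma> assms(3) by (intro order_tendstoD(2)[OF w]) (simp add: field_simps)
  moreover have "\<forall>\<^sub>F y in ?F. \<sigma> * w y - u y < 0"
    using \<sigma> by (intro order_tendstoD(2)[OF tendsto_diff[OF tendsto_mult[OF tendsto_const w] u]]) simp
  ultimately have "\<forall>\<^sub>F y in ?F. 0 \<le> w y \<and> \<sigma> * w y \<le> u y \<and> w y \<le> 1 / \<sigma>"
    by eventually_elim auto
  then obtain Pf Pg where Pf: "eventually Pf sequentially" and Pg: "eventually Pg (at_left 1)"
    and P: "\<And>n c. Pf n \<Longrightarrow> Pg c \<Longrightarrow> 0 \<le> w (n, c) \<and> \<sigma> * w (n, c) \<le> u (n, c) \<and> w (n, c) \<le> 1 / \<sigma>"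
    unfolding eventually_prod_filter by blast
  obtain N where N: "\<And>n. n \<ge> N \<Longrightarrow> Pf n"
    using Pf unfolding eventually_sequentially by blast
  let ?q = "\<lambda>c. meixner_q (\<alpha> + 1) c (1 + lam / c\<^sup>2)"
  \<comment> \<open>One more than the value at \<open>c = 1\<close>, so that continuity bounds
    \<open>q (Suc N)\<close> by \<open>M\<close> for all \<open>c\<close> near 1.\<close>
  define M where "M = ?q 1 (Suc N) + 1"
  have "((\<lambda>c. ?q c (Suc N)) \<longlongrightarrow> meixner_q (\<alpha> + 1) 1 (1 + lam / 1\<^sup>2) (Suc N)) (at_left 1)"
    using assms(1) by (intro tendsto_meixner_q tendsto_intros) auto
  then have "\<forall>\<^sub>F c in at_left 1. ?q c (Suc N) < M"
    by (rule order_tendstoD(2)) (simp add: M_def)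
  moreover have "\<forall>\<^sub>F c in at_left 1. c \<in> {0<..<1::real}"
    by (intro eventually_at_leftI[of 0]) auto
  ultimately have "\<forall>\<^sub>F c in at_left 1. \<forall>n. ?q c n \<le> M * (1 + 1 / (1 / \<sigma> - \<sigma>)) * (1 / \<sigma>) ^ n"
    using Pg
  proof eventually_elim
    case (elim c)
    have mono: "0 < ?q c n \<and> ?q c n \<le> ?q c (Suc n)" for n
      using elim assms by (intro meixner_q_mono) auto
    have "?q c (Suc (Suc n)) \<le> (w (n, c) + \<sigma>) * ?q c (Suc n) - u (n, c) * ?q c n" for n
    proof -
      have "real (Suc n) + \<alpha> > 0"
        using assms(1) by simp
      moreover have "?q c (Suc (Suc n)) = ((real (Suc n) + \<alpha> + (1 + lam / c\<^sup>2) * c * real (Suc n)) * ?q c (Suc n)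
        - c * real (Suc n) * ?q c n) / (real (Suc n) + \<alpha>)"
        by (simp add: add_ac)
      moreover have "((e + \<eta> * c * d) * x - c * d * y) / e = (1 + c * (d / e) * \<eta> - \<sigma> + \<sigma>) * x - c * (d / e) * y"
        if "e > 0" for e \<eta> d x y :: real
        using that by (simp add: field_simps)
      ultimately show ?thesis
        unfolding w_def u_def case_prod_conv by (simp only:)
    qed
    then show ?case
      using second_order_growth[of \<sigma> "?q c" N "\<lambda>n. w (n, c)" "\<lambda>n. u (n, c)" M] P[OF N] elim mono \<sigma> assms(3)
      by auto
  qed
  moreover have "M > 0"
    unfolding M_def using meixner_q_mono[of "\<alpha> + 1" 1 "1 + lam / 1\<^sup>2" "Suc N"] assms by simp
  moreover have "1 / \<sigma> - \<sigma> > 0"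
  proof -
    have "1 < 1 / \<sigma>"
      using \<sigma>(1) assms(3) by simp
    then show ?thesis
      using \<sigma>(1) by linarith
  qed
  ultimately show ?thesis
    by (intro exI[of _ "M * (1 + 1 / (1 / \<sigma> - \<sigma>))"]) (auto intro!: mult_pos_pos add_pos_pos)
qed

text \<open>Evaluated at \<open>c = 1\<close>, this is the corresponding term of the Laguerre series.\<close>

definition limit_term :: "real \<Rightarrow> real \<Rightarrow> complex \<Rightarrow> complex \<Rightarrow> nat \<Rightarrow> real \<Rightarrow> complex" where
  "limit_term \<alpha> lam x \<omega> n c =
     (\<Sum>k\<le>n. of_real (meixner_q (\<alpha> + 1) c (1 + lam / c\<^sup>2) k * c ^ (n - k)) * scaled_hyp \<alpha> x (1 - c) k) * \<omega> ^ n"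

section \<open>Identification of the terms and passage to the limit\<close>

lemma meixner_term_eq:
  assumes "\<alpha> > -1" "lam > 0" "0 < c" "c < 1"
    and "is_meixner_sobolev (\<alpha> + 1) c (lam / (1 - c)\<^sup>2) S"
  defines "q \<equiv> meixner_q (\<alpha> + 1) c (1 + lam / c\<^sup>2)"
  shows "meixner_eta c (lam / (1 - c)\<^sup>2) = 1 + lam / c\<^sup>2"
    and "of_real (q n) * cpoly (S n) (x / of_real (1 - c)) * of_real (c ^ n) * \<omega> ^ n = limit_term \<alpha> lam x \<omega> n c"
proof -
  have "(1 - 1 / c)\<^sup>2 = (1 - c)\<^sup>2 / c\<^sup>2"
    using assms(3) by (simp add: field_simps power2_eq_square)
  then show eta: "meixner_eta c (lam / (1 - c)\<^sup>2) = 1 + lam / c\<^sup>2"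
    using assms(4) by (simp add: meixner_eta_def)
  have "smult (q n) (S n) = (\<Sum>k\<le>n. smult (q k) (hyp_poly (meixner_basis c) \<alpha> k))"
    using meixner_connection[OF assms(3,4) _ _ assms(5), of n] assms(1,2)
    unfolding q_def eta by simp
  then have eq: "of_real (q n) * cpoly (S n) y = (\<Sum>k\<le>n. of_real (q k) * cpoly (hyp_poly (meixner_basis c) \<alpha> k) y)" for y
    by (metis (no_types, lifting) cpoly_simps(3) cpoly_sum sum.cong)
  \<comment> \<open>Of the factor \<open>c ^ n\<close>, the part \<open>c ^ k\<close> goes into
    \<open>scaled_hyp\<close> and the rest \<open>c ^ (n - k)\<close> stays with
    \<open>q k\<close>.\<close>
  have "of_real (q n) * cpoly (S n) (x / of_real (1 - c)) * of_real (c ^ n) =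
     (\<Sum>k\<le>n. of_real (q k * c ^ (n - k)) * (of_real (c ^ k) *
        cpoly (hyp_poly (meixner_basis c) \<alpha> k) (x / of_real (1 - c))))"
  proof -
    have "of_real (q k) * y * of_real (c ^ n) = of_real (q k * c ^ (n - k)) * (of_real (c ^ k) * y)"
      if "k \<le> n" for k and y :: complex
    proof -
      have "c ^ n = c ^ (n - k) * c ^ k"
        using that by (simp add: power_add[symmetric])
      then show ?thesis
        by (simp add: mult_ac)
    qed
    then show ?thesis
      unfolding eq sum_distrib_right by (intro sum.cong refl) simp
  qed
  then show "of_real (q n) * cpoly (S n) (x / of_real (1 - c)) * of_real (c ^ n) * \<omega> ^ n = limit_term \<alpha> lam x \<omega> n c"
    unfolding cpoly_hyp_poly_meixner[OF assms(3,4)] limit_term_def q_def by simp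
qed

lemma laguerre_term_eq:
  assumes "\<alpha> > -1" "lam > 0" "is_laguerre_sobolev \<alpha> lam S"
  shows "of_real (laguerre_q \<alpha> lam n) * cpoly (S n) x * \<omega> ^ n = limit_term \<alpha> lam x \<omega> n 1"
proof -
  have "smult (laguerre_q \<alpha> lam n) (S n) = (\<Sum>k\<le>n. smult (laguerre_q \<alpha> lam k) (hyp_poly laguerre_basis \<alpha> k))"
    using laguerre_connection[OF assms(1) _ assms(3), of n] assms(2) by simp
  then have "of_real (laguerre_q \<alpha> lam n) * cpoly (S n) x =
      (\<Sum>k\<le>n. of_real (laguerre_q \<alpha> lam k) * cpoly (hyp_poly laguerre_basis \<alpha> k) x)"
    by (metis (no_types, lifting) cpoly_simps(3) cpoly_sum sum.cong)
  then show ?thesis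
    by (simp add: limit_term_def laguerre_q_eq cpoly_hyp_poly_laguerre)
qed

text \<open>The gap above \<open>norm \<omega>\<close> is used twice: \<open>\<sigma>\<close> bounds
  the growth of the coefficients, and \<open>\<tau>\<close> with
  \<open>norm \<omega> / \<sigma> < \<tau> < 1\<close> absorbs the scaled polynomials. The ratio
  \<open>\<theta>\<close> stays below 1 and yields a summable majorant independent of
  \<open>c\<close>.\<close>

lemma limit_term_tannery:
  assumes "\<alpha> > -1" "lam > 0" "norm \<omega> < (lam + 2 - sqrt (lam\<^sup>2 + 4 * lam)) / 2"
  shows "(\<forall>\<^sub>F c in at_left 1. summable (\<lambda>n. norm (limit_term \<alpha> lam x \<omega> n c))) \<and>
    summable (\<lambda>n. norm (limit_term \<alpha> lam x \<omega> n 1)) \<and>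
    ((\<lambda>c. \<Sum>n. limit_term \<alpha> lam x \<omega> n c) \<longlongrightarrow> (\<Sum>n. limit_term \<alpha> lam x \<omega> n 1)) (at_left 1)"
proof -
  obtain \<sigma> where \<sigma>: "norm \<omega> < \<sigma>" "\<sigma> < (lam + 2 - sqrt (lam\<^sup>2 + 4 * lam)) / 2"
    using dense[OF assms(3)] by blast
  then have \<sigma>0: "0 < \<sigma>"
    using norm_ge_zero[of \<omega>] by linarith
  have \<sigma>1: "\<sigma> < 1"
    using below_small_root[OF assms(2) \<sigma>(2)] by simp
  obtain C where C: "C > 0"
    and q_le: "\<forall>\<^sub>F c in at_left 1. \<forall>n. meixner_q (\<alpha> + 1) c (1 + lam / c\<^sup>2) n \<le> C * (1 / \<sigma>) ^ n"
    using eventually_meixner_q_le[OF assms(1,2) \<sigma>0 \<sigma>(2)] by blast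
  have "norm \<omega> / \<sigma> < 1"
    using \<sigma> \<sigma>0 by simp
  then obtain \<tau> where \<tau>: "norm \<omega> / \<sigma> < \<tau>" "\<tau> < 1"
    using dense by blast
  then have \<tau>0: "0 < \<tau>"
    using \<sigma>0 by (meson divide_nonneg_pos le_less_trans norm_ge_zero)
  obtain K \<delta> where K: "K > 0" and \<delta>: "\<delta> > 0"
    and P_le: "\<And>t k. 0 \<le> t \<Longrightarrow> t \<le> \<delta> \<Longrightarrow> t \<le> 1 \<Longrightarrow> norm (scaled_hyp \<alpha> x t k) \<le> K / \<tau> ^ k"
    using scaled_hyp_bound[OF \<tau>0 \<tau>(2)] by blast
  define \<theta> where "\<theta> = norm \<omega> / \<sigma> / \<tau>"
  have \<theta>: "0 \<le> \<theta>" "\<theta> < 1"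
    using \<tau> \<tau>0 \<sigma>0 by (auto simp: \<theta>_def pos_divide_less_eq mult.commute)
  \<comment> \<open>The factor \<open>Suc n\<close> counts the summands \<open>k \<le> n\<close>,
    each of which is bounded by its value at \<open>k = n\<close>.\<close>
  define B where "B = (\<lambda>n. C * K * (real (Suc n) * \<theta> ^ n))"
  have "summable B"
    unfolding B_def using geometric_deriv_sums[of \<theta>] \<theta> by (intro summable_mult) (auto simp: sums_iff)
  have near: "\<forall>\<^sub>F c in at_left 1. c \<in> {max 0 (1 - \<delta>)<..<1::real}"
    using \<delta> by (intro eventually_at_leftI[of "max 0 (1 - \<delta>)"]) auto
  have bound: "\<forall>\<^sub>F c in at_left 1. \<forall>n. norm (limit_term \<alpha> lam x \<omega> n c) \<le> B n"
    using q_le near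
  proof eventually_elim
    case (elim c)
    let ?q = "meixner_q (\<alpha> + 1) c (1 + lam / c\<^sup>2)"
    have c: "0 < c" "c < 1" "0 \<le> 1 - c" "1 - c \<le> \<delta>" "1 - c \<le> 1"
      using elim(2) by auto
    show ?case
    proof
      fix n
      have "norm (limit_term \<alpha> lam x \<omega> n c) \<le>
          (\<Sum>k\<le>n. norm (of_real (?q k * c ^ (n - k)) * scaled_hyp \<alpha> x (1 - c) k)) * norm \<omega> ^ n"
        unfolding limit_term_def norm_mult[of _ "\<omega> ^ n"] norm_power by (intro mult_right_mono norm_sum) auto
      also have "\<dots> \<le> (\<Sum>k\<le>n. C * K * (1 / \<sigma> / \<tau>) ^ n) * norm \<omega> ^ n"
      proof (intro mult_right_mono sum_mono)
        fix k assume k: "k \<in> {..n}"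
        have q0: "0 < ?q k"
          using meixner_q_mono[of "\<alpha> + 1" c "1 + lam / c\<^sup>2" k] assms c by simp
        have "?q k * c ^ (n - k) \<le> C * (1 / \<sigma>) ^ k * 1"
          using elim(1) q0 c C \<sigma>0 by (intro mult_mono power_le_one) auto
        then have "norm (of_real (?q k * c ^ (n - k)) * scaled_hyp \<alpha> x (1 - c) k) \<le> C * (1 / \<sigma>) ^ k * (K / \<tau> ^ k)"
          unfolding norm_mult[of "of_real _"] norm_of_real using q0 c C \<sigma>0 P_le[OF c(3-5), of k]
          by (intro mult_mono) auto
        also have "\<dots> = C * K * (1 / \<sigma> / \<tau>) ^ k"
          by (simp add: power_divide power_mult_distrib)
        also have "\<dots> \<le> C * K * (1 / \<sigma> / \<tau>) ^ n"
        proof -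
          have "1 \<le> 1 / \<sigma> / \<tau>"
            using \<sigma>0 \<sigma>1 \<tau>0 \<tau>(2) by (simp add: mult_le_one)
          then show ?thesis
            using k C K by (intro mult_left_mono power_increasing) auto
        qed
        finally show "norm (of_real (?q k * c ^ (n - k)) * scaled_hyp \<alpha> x (1 - c) k) \<le> C * K * (1 / \<sigma> / \<tau>) ^ n" .
      qed auto
      also have "\<dots> = B n"
        by (simp add: B_def \<theta>_def power_divide)
      finally show "norm (limit_term \<alpha> lam x \<omega> n c) \<le> B n" .
    qed
  qed
  show ?thesis
  proof (rule tannerys_theorem[OF _ _ \<open>summable B\<close>])
    show "((\<lambda>c. limit_term \<alpha> lam x \<omega> n c) \<longlongrightarrow> limit_term \<alpha> lam x \<omega> n 1) (at_left 1)" for n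
    proof -
      have "((\<lambda>c. 1 + lam / c\<^sup>2) \<longlongrightarrow> 1 + lam / 1\<^sup>2) (at_left 1)"
        "((\<lambda>c. 1 - c) \<longlongrightarrow> 1 - 1) (at_left (1::real))"
        by (intro tendsto_intros; simp)+
      then show ?thesis
        unfolding limit_term_def using assms(1)
        by (intro tendsto_intros tendsto_meixner_q tendsto_scaled_hyp) auto
    qed
    show "\<forall>\<^sub>F (n, c) in sequentially \<times>\<^sub>F at_left 1. norm (limit_term \<alpha> lam x \<omega> n c) \<le> B n"
      unfolding eventually_prod_filter
      by (rule exI[of _ "\<lambda>_. True"], rule exI[of _ "\<lambda>c. \<forall>n. norm (limit_term \<alpha> lam x \<omega> n c) \<le> B n"])
        (use bound in auto)
  qed simp
qed

theorem mainTheorem3: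
  fixes \<alpha> lamt :: real
    and S :: "real \<Rightarrow> nat \<Rightarrow> real poly"
    and SL :: "nat \<Rightarrow> real poly"
    and x \<omega> :: complex
  assumes "\<alpha> > -1" and "lamt > 0"
    and "\<And>c. 0 < c \<Longrightarrow> c < 1 \<Longrightarrow> is_meixner_sobolev (\<alpha> + 1) c (lamt / (1 - c)\<^sup>2) (S c)"
    and "is_laguerre_sobolev \<alpha> lamt SL"
    and "norm \<omega> < (lamt + 2 - sqrt (lamt\<^sup>2 + 4 * lamt)) / 2"
  shows
    "(\<forall>\<^sub>F c in at_left 1. summable (\<lambda>n.
        of_real (meixner_q (\<alpha> + 1) c (meixner_eta c (lamt / (1 - c)\<^sup>2)) n)
        * cpoly (S c n) (x / of_real (1 - c)) * (of_real c * \<omega>) ^ n)) \<and>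
     summable (\<lambda>n. of_real (laguerre_q \<alpha> lamt n) * cpoly (SL n) x * \<omega> ^ n) \<and>
     ((\<lambda>c. G_M (\<alpha> + 1) c (S c) (x / of_real (1 - c)) (of_real c * \<omega>) (lamt / (1 - c)\<^sup>2))
        \<longlongrightarrow> G_L \<alpha> SL x \<omega> lamt) (at_left 1) \<and>
     ((\<lambda>c. \<Sum>n. of_real (meixner_q (\<alpha> + 1) c (1 + lamt / c\<^sup>2) n)
              * cpoly (S c n) (x / of_real (1 - c)) * of_real (c ^ n) * \<omega> ^ n)
        \<longlongrightarrow> G_L \<alpha> SL x \<omega> lamt) (at_left 1)"
proof -
  let ?T = "limit_term \<alpha> lamt x \<omega>"
  note tannery = limit_term_tannery[OF assms(1,2,5), of x]
  \<comment> \<open>The Meixner systems are given only for \<open>0 < c < 1\<close>, so the series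
    are identified eventually as \<open>c\<close> tends to 1 from the left.\<close>
  have near: "\<forall>\<^sub>F c in at_left 1. c \<in> {0<..<1::real}"
    by (intro eventually_at_leftI[of 0]) auto
  have eq1: "of_real (meixner_q (\<alpha> + 1) c (meixner_eta c (lamt / (1 - c)\<^sup>2)) n)
        * cpoly (S c n) (x / of_real (1 - c)) * (of_real c * \<omega>) ^ n = ?T n c"
    and eq2: "of_real (meixner_q (\<alpha> + 1) c (1 + lamt / c\<^sup>2) n)
        * cpoly (S c n) (x / of_real (1 - c)) * of_real (c ^ n) * \<omega> ^ n = ?T n c"
    if "c \<in> {0<..<1}" for c n
  proof -
    note eq = meixner_term_eq[of \<alpha> lamt c "S c"]
    show "of_real (meixner_q (\<alpha> + 1) c (1 + lamt / c\<^sup>2) n)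
        * cpoly (S c n) (x / of_real (1 - c)) * of_real (c ^ n) * \<omega> ^ n = ?T n c"
      using that assms by (intro eq(2)) auto
    then show "of_real (meixner_q (\<alpha> + 1) c (meixner_eta c (lamt / (1 - c)\<^sup>2)) n)
        * cpoly (S c n) (x / of_real (1 - c)) * (of_real c * \<omega>) ^ n = ?T n c"
      using that assms eq(1) by (simp add: power_mult_distrib mult.assoc)
  qed
  have L: "of_real (laguerre_q \<alpha> lamt n) * cpoly (SL n) x * \<omega> ^ n = ?T n 1" for n
    by (rule laguerre_term_eq[OF assms(1,2,4)])
  have lim: "((\<lambda>c. \<Sum>n. ?T n c) \<longlongrightarrow> G_L \<alpha> SL x \<omega> lamt) (at_left 1)"
    unfolding G_L_def L using tannery by blast
  have "\<forall>\<^sub>F c in at_left 1. summable (\<lambda>n.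
        of_real (meixner_q (\<alpha> + 1) c (meixner_eta c (lamt / (1 - c)\<^sup>2)) n)
        * cpoly (S c n) (x / of_real (1 - c)) * (of_real c * \<omega>) ^ n)"
    using conjunct1[OF tannery] near by eventually_elim (simp only: eq1 summable_norm_cancel)
  moreover have "summable (\<lambda>n. of_real (laguerre_q \<alpha> lamt n) * cpoly (SL n) x * \<omega> ^ n)"
    unfolding L using tannery by (blast intro: summable_norm_cancel)
  moreover have "((\<lambda>c. G_M (\<alpha> + 1) c (S c) (x / of_real (1 - c)) (of_real c * \<omega>) (lamt / (1 - c)\<^sup>2))
        \<longlongrightarrow> G_L \<alpha> SL x \<omega> lamt) (at_left 1)"
    by (rule Lim_transform_eventually[OF lim]) (use near in eventually_elim, simp only: G_M_def eq1)
  moreover have "((\<lambda>c. \<Sum>n. of_real (meixner_q (\<alpha> + 1) c (1 + lamt / c\<^sup>2) n)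
              * cpoly (S c n) (x / of_real (1 - c)) * of_real (c ^ n) * \<omega> ^ n)
        \<longlongrightarrow> G_L \<alpha> SL x \<omega> lamt) (at_left 1)"
    by (rule Lim_transform_eventually[OF lim]) (use near in eventually_elim, simp only: eq2)
  ultimately show ?thesis
    by blast
qed

end
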